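(* Let $k>0$, $\gamma>0$, $\kappa\in(0,1)$ and a positive integer $P$ be fixed, let $D=[0,1]^3$, let $N(x)=1/\gamma^3$, and let $h:D\to\mathbb{C}$ be a function with $\operatorname{Im}h\le 0$ such that $p(x):=4\pi h(x)N(x)\in C(D)$ satisfies $$|p(x)-p(y)|\le \omega_p(|x-y|)\qquad\text{for all } x,y\in D,$$ where $\omega_p$ is the modulus of continuity of $p$. Let $u$ be the solution of the integral equation $$u(x)+\int_D g(x,y)p(y)u(y)\,dy=u_0(x),\qquad x\in D .$$ For $M=(mP)^3$, $m=1,2,\dots$, let $x_1,\dots,x_M$ be the centers of the cubes of side length $1/(mP)$ partitioning $D$, let $a_{mP}\in(0,1/(mP))$ be the solution of $\frac{1}{mP}-2a_{mP}=\gamma a_{mP}^{(2-\kappa)/3}$, let $u_M:=(u(x_1),\dots,u(x_M))^T\in\mathbb{C}^M$, and, for $M$ sufficiently large, let $u_{e,M}=(u_e(x_1),\dots,u_e(x_M))^T\in\mathbb{C}^M$ be the solution of the linear algebraic system $$u_e(x_l)=u_0(x_l)-4\pi\sum_{j=1,\,j\ne l}^{M} g(x_l,x_j)h(x_j)\,a_{mP}^{2-\kappa}\,u_e(x_j),\qquad l=1,\dots,M .$$ Then, as $M\to\infty$, $$\|u_M-u_{e,M}\|_{\mathbb{C}^M}=O\!\left(\frac{\log M}{M^{1/3}}+\bigl|1-\gamma^3 M a_{mP}^{2-\kappa}\bigr|+\omega_p\!\left(\frac{1}{M^{1/3}}\right)\right).$$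
   Context: $g(x,y):=\dfrac{e^{ik|x-y|}}{4\pi|x-y|}$ for $x\ne y$ in $\mathbb{R}^3$. $u_0(x)=e^{ik\alpha\cdot x}$ with $\alpha\in\mathbb{R}^3$ a fixed unit vector is the incident plane wave. The modulus of continuity is $\omega_p(t)=\sup\{|p(x)-p(y)|: x,y\in D,\ |x-y|\le t\}$. $\|v\|_{\mathbb{C}^M}:=\max_{1\le j\le M}|v_j|$. $M$ runs only over the numbers $(mP)^3$ with $P$ fixed and $m\to\infty$; the constant in $O(\cdot)$ is independent of $m$. Here $a_{mP}$ is the common radius of $M$ balls embedded in $D$, one centered at each $x_j$; the equation defining $a_{mP}$ has exactly one positive solution and says that the minimal distance between distinct balls is $\gamma a_{mP}^{(2-\kappa)/3}$. The integral equation is uniquely solvable, and the linear system is uniquely solvable for all sufficiently large $M$. *)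

theory Defs
  imports "HOL-Analysis.Analysis" "HOL-Library.Landau_Symbols"
begin

abbreviation unit_cube :: "(real^3) set" where
  "unit_cube \<equiv> cbox 0 1"

(* On the diagonal the value is 0, because x / 0 = 0; neither the volume integral
   nor the linear system (j ~= l) depends on it. *)
definition green :: "real \<Rightarrow> real^3 \<Rightarrow> real^3 \<Rightarrow> complex" where
  "green k x y = exp (\<i> * complex_of_real (k * norm (x - y))) / complex_of_real (4 * pi * norm (x - y))"

definition plane_wave :: "real \<Rightarrow> real^3 \<Rightarrow> real^3 \<Rightarrow> complex" where
  "plane_wave k \<alpha> x = exp (\<i> * complex_of_real (k * (\<alpha> \<bullet> x)))"

definition distribution_density :: "real \<Rightarrow> real^3 \<Rightarrow> real" where
  "distribution_density \<gamma> x = 1 / \<gamma> ^ 3"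

definition potential :: "real \<Rightarrow> (real^3 \<Rightarrow> complex) \<Rightarrow> real^3 \<Rightarrow> complex" where
  "potential \<gamma> h x = 4 * complex_of_real pi * h x * complex_of_real (distribution_density \<gamma> x)"

definition modulus_of_continuity :: "(real^3 \<Rightarrow> complex) \<Rightarrow> real \<Rightarrow> real" where
  "modulus_of_continuity p t =
     Sup {cmod (p x - p y) | x y. x \<in> unit_cube \<and> y \<in> unit_cube \<and> norm (x - y) \<le> t}"

(* Solutions are sought in C(D); the values of u outside D are irrelevant. *)
definition solves_integral_equation ::
  "real \<Rightarrow> real^3 \<Rightarrow> (real^3 \<Rightarrow> complex) \<Rightarrow> (real^3 \<Rightarrow> complex) \<Rightarrow> bool" where
  "solves_integral_equation k \<alpha> p u \<longleftrightarrow>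
     continuous_on unit_cube u \<and>
     (\<forall>x\<in>unit_cube. u x + (LINT y:unit_cube|lborel. green k x y * p y * u y) = plane_wave k \<alpha> x)"

(* The point with index q is the center of the cube with sides
   [q_i / n, (q_i + 1) / n]; these n^3 cubes partition D up to common faces. *)
definition cube_centers :: "nat \<Rightarrow> (real^3) set" where
  "cube_centers n = {(\<chi> i. (real (q $ i) + 1 / 2) / real n) | q :: nat^3. \<forall>i. q $ i < n}"

(* c 1, ..., c M are the collocation points, v j is the unknown at c j, a the common radius. *)
definition solves_linear_system ::
  "real \<Rightarrow> real^3 \<Rightarrow> (real^3 \<Rightarrow> complex) \<Rightarrow> real \<Rightarrow> real \<Rightarrow> nat \<Rightarrow> (nat \<Rightarrow> real^3) \<Rightarrow> (nat \<Rightarrow> complex) \<Rightarrow> bool" where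
  "solves_linear_system k \<alpha> h \<kappa> a M c v \<longleftrightarrow>
     (\<forall>l\<in>{1..M}. v l = plane_wave k \<alpha> (c l) - 4 * complex_of_real pi *
        (\<Sum>j\<in>{1..M} - {l}. green k (c l) (c j) * h (c j) * complex_of_real (a powr (2 - \<kappa>)) * v j))"

definition max_norm :: "nat \<Rightarrow> (nat \<Rightarrow> complex) \<Rightarrow> real" where
  "max_norm M v = Max ((\<lambda>j. cmod (v j)) ` {1..M})"

end

theory Submission
  imports Defs "HOL-Complex_Analysis.Great_Picard"
begin

text \<open>
The argument is the classical one for collocation methods: consistency and stability imply
convergence. Write \<open>n = mP\<close>, let \<open>T\<close> be the integral operator with kernel \<open>g(x,y) p(y)\<close>, and put
\<open>s = \<gamma>^3 M a^(2-\<kappa>)\<close>. Since \<open>4 \<pi> h = \<gamma>^3 p\<close>, the linear system reads \<open>v + s T\<^sub>n v = u\<^sub>0\<close> at the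
centers, where \<open>T\<^sub>n v(x) = n^-3 \<Sum> g(x,z) p(z) v(z)\<close> is summed over all centers \<open>z\<close>; the convention
\<open>g(x,x) = 0\<close> takes care of the excluded term (\<open>linear_system_as_discrete_potential\<close>). The equation for
the radius says \<open>s = (1 - 2 n a)^3\<close>, and it forces \<open>n a \<longlonglongrightarrow> 0\<close>, so \<open>s \<longlonglongrightarrow> 1\<close> (\<open>radius_scaling_limit\<close>).

All estimates rest on one bound: the integral of \<open>1 / |x - y|\<^sup>2\<close> over the cube is bounded uniformly in
\<open>x\<close>. Both the increments of \<open>g\<close> in its first argument and the change of \<open>g(x,y)\<close> when \<open>y\<close> moves to
the center of its cell are dominated by this kernel times the displacement. Hence potentials of bounded
densities are Lipschitz continuous, which makes \<open>u\<close> Lipschitz continuous, and the midpoint sum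
differs from the potential of the corresponding step function by \<open>O(1/n)\<close>.

Consistency (\<open>discrete_potential_consistency\<close>): inserting \<open>u\<close> into the linear system leaves a residual
of order \<open>1/n + |1 - s| + \<omega>\<^sub>p(1/n)\<close>; the last term comes from replacing \<open>p\<close> by its values at the
centers.

Stability (\<open>discrete_stability\<close>): for large \<open>n\<close> the grid function \<open>e\<close> is bounded by a fixed multiple
of \<open>e + s T\<^sub>n e\<close>. Otherwise there are grid functions of maximum 1 whose residuals tend to 0. The
potentials of the associated step functions are equibounded and equi-Lipschitz, so by Arzela-Ascoli a
subsequence converges uniformly to some \<open>w\<close>. The grid functions then converge to \<open>- w\<close>, and passing to
the limit gives \<open>w + T w = 0\<close>. Unique solvability of the integral equation forces \<open>w = 0\<close>, which
contradicts maximum 1 (\<open>discrete_homogeneous_limit\<close>).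

Applying stability to the error \<open>u - u\<^sub>e\<close> bounds it by a multiple of \<open>1/n + |1 - s| + \<omega>\<^sub>p(1/n)\<close>. This is slightly
sharper than the assertion, because \<open>1/n\<close> is at most \<open>log M / M^(1/3)\<close> once \<open>M\<close> exceeds \<open>e\<close>.
\<close>

section \<open>An integrable singularity in three dimensions\<close>

text \<open>
This is the one-dimensional factor in the estimate of the singular integral. The value \<open>\<infinity>\<close> at 0
makes the product bound below hold at every point of space, including the coordinate hyperplanes,
where \<open>0 powr (-2/3) = 0\<close> would break it.
\<close>

lemma nn_integral_abs_powr_minus_two_thirds:
  "(\<integral>\<^sup>+t. (if t = 0 then \<infinity> else ennreal (\<bar>t\<bar> powr (-2/3))) * indicator {-1..1} t \<partial>lborel) \<le> 6"
proof -
  define \<psi> :: "real \<Rightarrow> ennreal" where "\<psi> t = ennreal (t powr (-2/3)) * indicator {0..1} t" for t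
  have [measurable]: "\<psi> \<in> borel_measurable borel"
    unfolding \<psi>_def by measurable
  have "((\<lambda>t::real. t powr (-2/3)) has_integral (1 powr (-2/3+1) / (-2/3+1))) {0..1}"
    by (rule has_integral_powr_from_0) auto
  then have "((\<lambda>t::real. t powr (-2/3)) has_integral 3) {0..1}" by simp
  then have \<psi>3: "integral\<^sup>N lborel \<psi> = 3"
    unfolding \<psi>_def by (subst nn_integral_has_integral_lebesgue') auto
  have \<psi>3': "(\<integral>\<^sup>+t. \<psi> (- t) \<partial>lborel) = 3"
    using nn_integral_real_affine[of \<psi> "-1" 0] \<psi>3 by simp
  have "AE t in lborel. (if t = 0 then \<infinity> else ennreal (\<bar>t\<bar> powr (-2/3))) * indicator {-1..1} t \<le> \<psi> t + \<psi> (- t)"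
    using AE_lborel_singleton[of "0::real"]
  proof eventually_elim
    case (elim t)
    then show ?case
      by (cases "t > 0") (auto simp: \<psi>_def indicator_def)
  qed
  then have "(\<integral>\<^sup>+t. (if t = 0 then \<infinity> else ennreal (\<bar>t\<bar> powr (-2/3))) * indicator {-1..1} t \<partial>lborel)
      \<le> (\<integral>\<^sup>+t. \<psi> t + \<psi> (- t) \<partial>lborel)"
    by (rule nn_integral_mono_AE)
  also have "\<dots> = 6"
    by (subst nn_integral_add) (auto simp: \<psi>3 \<psi>3')
  finally show ?thesis .
qed

text \<open>
Each coordinate of \<open>v = x - y\<close> is at most \<open>|v|\<close>, so \<open>1 / |v|\<^sup>2\<close> is at most the product over the three
coordinates of \<open>|v\<^sub>b|^(-2/3)\<close>. The product separates, and each factor has integral at most 6 because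
the coordinates of \<open>v\<close> lie in \<open>[-1,1]\<close>; this gives \<open>6^3 = 216\<close>.
\<close>

lemma nn_integral_inverse_square_cube:
  fixes x :: "real^3"
  assumes x: "x \<in> unit_cube"
  shows "(\<integral>\<^sup>+y. ennreal (1 / (norm (x - y))\<^sup>2) * indicator unit_cube y \<partial>lborel) \<le> 216"
proof -
  define \<phi> :: "real \<Rightarrow> ennreal"
    where "\<phi> t = (if t = 0 then \<infinity> else ennreal (\<bar>t\<bar> powr (-2/3))) * indicator {-1..1} t" for t
  have [measurable]: "\<phi> \<in> borel_measurable borel"
    unfolding \<phi>_def by measurable
  have \<phi>6: "(\<integral>\<^sup>+t. \<phi> (s - t) \<partial>lborel) \<le> 6" for s
    using nn_integral_real_affine[of \<phi> "-1" s] nn_integral_abs_powr_minus_two_thirds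
    by (simp add: \<phi>_def[abs_def])
  have bound: "ennreal (1 / (norm (x - y))\<^sup>2) * indicator unit_cube y \<le> (\<Prod>b\<in>Basis. \<phi> (x \<bullet> b - y \<bullet> b))" for y
  proof (cases "y \<in> unit_cube \<and> y \<noteq> x")
    case True
    then have r: "norm (x - y) > 0" by auto
    have one: "ennreal (norm (x - y) powr (-2/3)) \<le> \<phi> (x \<bullet> b - y \<bullet> b)" if b: "b \<in> Basis" for b
    proof -
      have "\<bar>x \<bullet> b - y \<bullet> b\<bar> \<le> norm (x - y)"
        using Basis_le_norm[OF b, of "x - y"] by (simp add: inner_diff_left)
      moreover have "\<bar>x \<bullet> b - y \<bullet> b\<bar> \<le> 1"
      proof -
        have ib: "(1::real^3) \<bullet> b = 1"
          using b by (auto simp: Basis_vec_def inner_axis)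
        have "0 \<le> x \<bullet> b" "x \<bullet> b \<le> 1" "0 \<le> y \<bullet> b" "y \<bullet> b \<le> 1"
          using x True b ib unfolding mem_box by fastforce+
        then show ?thesis by simp
      qed
      ultimately show ?thesis
        by (auto simp: \<phi>_def indicator_def abs_le_iff intro!: ennreal_leI powr_mono2')
    qed
    have "(norm (x - y) powr (-2/3)) ^ 3 = norm (x - y) powr (-2)"
      using r by (simp add: powr_powr flip: powr_realpow)
    also have "\<dots> = 1 / (norm (x - y))\<^sup>2"
      using r by (simp add: powr_minus_divide)
    finally have "1 / (norm (x - y))\<^sup>2 = (\<Prod>b\<in>(Basis::(real^3) set). norm (x - y) powr (-2/3))"
      by simp
    then have "ennreal (1 / (norm (x - y))\<^sup>2)
        = (\<Prod>b\<in>(Basis::(real^3) set). ennreal (norm (x - y) powr (-2/3)))"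
      by (simp add: prod_ennreal del: prod_constant)
    also have "\<dots> \<le> (\<Prod>b\<in>Basis. \<phi> (x \<bullet> b - y \<bullet> b))"
      by (intro prod_mono_ennreal) (use one in auto)
    finally show ?thesis using True by simp
  qed (auto simp: indicator_def)
  have "(\<integral>\<^sup>+y. ennreal (1 / (norm (x - y))\<^sup>2) * indicator unit_cube y \<partial>lborel)
      \<le> (\<integral>\<^sup>+y. (\<Prod>b\<in>Basis. \<phi> (x \<bullet> b - y \<bullet> b)) \<partial>lborel)"
    by (intro nn_integral_mono bound)
  also have "\<dots> = (\<Prod>b\<in>(Basis::(real^3) set). \<integral>\<^sup>+t. \<phi> (x \<bullet> b - t) \<partial>lborel)"
    by (rule nn_integral_lborel_prod) auto
  also have "\<dots> \<le> (\<Prod>b\<in>(Basis::(real^3) set). 6)"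
    by (intro prod_mono_ennreal) (use \<phi>6 in auto)
  also have "\<dots> = 216" by simp
  finally show ?thesis .
qed

lemma inverse_square_integrable_cube:
  fixes x :: "real^3"
  assumes x: "x \<in> unit_cube"
  shows "set_integrable lborel unit_cube (\<lambda>y. 1 / (norm (x - y))\<^sup>2)"
    and "(LINT y:unit_cube|lborel. 1 / (norm (x - y))\<^sup>2) \<le> 216"
proof -
  have eq: "(\<integral>\<^sup>+y. ennreal (indicator unit_cube y *\<^sub>R (1 / (norm (x - y))\<^sup>2)) \<partial>lborel)
      = (\<integral>\<^sup>+y. ennreal (1 / (norm (x - y))\<^sup>2) * indicator unit_cube y \<partial>lborel)"
    by (intro nn_integral_cong) (auto simp: indicator_def)
  have le: "(\<integral>\<^sup>+y. ennreal (indicator unit_cube y *\<^sub>R (1 / (norm (x - y))\<^sup>2)) \<partial>lborel) \<le> ennreal 216"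
    unfolding eq using nn_integral_inverse_square_cube[OF x] by simp
  show int: "set_integrable lborel unit_cube (\<lambda>y. 1 / (norm (x - y))\<^sup>2)"
    unfolding set_integrable_def
    by (rule integrableI_nonneg) (use le in \<open>auto simp: le_less_trans\<close>)
  show "(LINT y:unit_cube|lborel. 1 / (norm (x - y))\<^sup>2) \<le> 216"
    unfolding set_lebesgue_integral_def
    by (rule integral_real_bounded) (use le in auto)
qed

section \<open>Pointwise estimates for the Green function\<close>

text \<open>
The crude diameter 3 is enough: it serves to absorb \<open>1/r\<close> into \<open>3/r\<^sup>2\<close> on the cube, and being below
\<open>4 \<pi>\<close> it bounds the Green function by \<open>1/r\<^sup>2\<close>.
\<close>

lemma norm_diff_unit_cube_le:
  fixes x y :: "real^3"
  assumes "x \<in> unit_cube" "y \<in> unit_cube"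
  shows "norm (x - y) \<le> 3"
proof -
  have "\<bar>(x - y) $ i\<bar> \<le> 1" for i
    using assms[unfolded mem_box_cart, THEN spec, of i] by auto
  then have "(\<Sum>i\<in>UNIV. \<bar>(x - y) $ i\<bar>) \<le> (\<Sum>i\<in>(UNIV::3 set). 1)"
    by (intro sum_mono)
  then show ?thesis
    using norm_le_l1_cart[of "x - y"] by simp
qed

lemma norm_exp_i_diff_le:
  fixes s t :: real
  shows "cmod (exp (\<i> * complex_of_real s) - exp (\<i> * complex_of_real t)) \<le> \<bar>s - t\<bar>"
proof -
  have "exp (\<i> * complex_of_real s) - exp (\<i> * complex_of_real t)
      = exp (\<i> * complex_of_real t) * (exp (\<i> * complex_of_real (s - t)) - 1)"
    by (simp add: algebra_simps flip: exp_add)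
  then have "cmod (exp (\<i> * complex_of_real s) - exp (\<i> * complex_of_real t)) = 2 * \<bar>sin ((s - t) / 2)\<bar>"
    by (simp only: norm_mult norm_exp_i_times dist_exp_i_1)
  also have "\<dots> \<le> \<bar>s - t\<bar>"
    using abs_sin_x_le_abs_x[of "(s - t) / 2"] by simp
  finally show ?thesis .
qed

lemma norm_green: "cmod (green k x y) = 1 / (4 * pi * norm (x - y))"
  by (simp add: green_def norm_divide norm_mult)

lemma green_diag [simp]: "green k x x = 0"
  by (simp add: green_def)

lemma norm_green_le:
  assumes "x \<in> unit_cube" "y \<in> unit_cube"
  shows "cmod (green k x y) \<le> 1 / (norm (x - y))\<^sup>2"
proof (cases "x = y")
  case False
  define r where "r = norm (x - y)"
  have r: "0 < r" "r \<le> 3"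
    using False norm_diff_unit_cube_le[OF assms] by (auto simp: r_def)
  have "r \<le> 4 * pi" using r pi_gt3 by linarith
  then have "1 / (4 * pi * r) \<le> 1 / r\<^sup>2"
    using r by (simp add: field_simps power2_eq_square)
  then show ?thesis by (simp add: norm_green r_def)
qed simp

text \<open>
The phase and the modulus are varied one at a time:
\<open>e^(ikr)/r - e^(ikr')/r' = (e^(ikr) - e^(ikr'))/r + e^(ikr') (1/r - 1/r')\<close>. The factor \<open>1/(4 \<pi>)\<close> is
dropped. Both arguments are allowed to move, since the lemma is applied to increments in either one.
\<close>

lemma green_diff_le:
  assumes k: "k \<ge> 0" and "x \<noteq> y" "x' \<noteq> y'" and d: "\<bar>norm (x - y) - norm (x' - y')\<bar> \<le> d"
  shows "cmod (green k x y - green k x' y')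
      \<le> d * (k / norm (x - y) + 1 / (norm (x - y) * norm (x' - y')))"
proof -
  define r r' where "r = norm (x - y)" and "r' = norm (x' - y')"
  have r: "r > 0" "r' > 0" using assms by (auto simp: r_def r'_def)
  have d': "\<bar>r - r'\<bar> \<le> d" using d by (simp add: r_def r'_def)
  define E E' where "E = exp (\<i> * complex_of_real (k * r))" and "E' = exp (\<i> * complex_of_real (k * r'))"
  have E': "cmod E' = 1" by (simp add: E'_def)
  have "cmod (E - E') \<le> \<bar>k * r - k * r'\<bar>"
    unfolding E_def E'_def by (rule norm_exp_i_diff_le)
  also have "\<dots> = k * \<bar>r - r'\<bar>" using k by (simp add: abs_mult flip: right_diff_distrib)
  finally have EE: "cmod (E - E') \<le> k * d"
    using mult_left_mono[OF d' k] by linarith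
  have "green k x y - green k x' y' = ((E - E') / of_real r + E' * of_real ((r' - r) / (r * r'))) / of_real (4 * pi)"
    using r by (simp add: green_def E_def E'_def r_def[symmetric] r'_def[symmetric] field_simps)
  then have "cmod (green k x y - green k x' y')
      = cmod ((E - E') / of_real r + E' * of_real ((r' - r) / (r * r'))) / (4 * pi)"
    by (simp only: norm_divide norm_of_real) simp
  also have "\<dots> \<le> cmod ((E - E') / of_real r + E' * of_real ((r' - r) / (r * r')))"
    using pi_gt3 by (simp add: divide_le_eq mult_le_cancel_left1)
  also have "\<dots> \<le> cmod (E - E') / r + \<bar>r' - r\<bar> / (r * r')"
    using r norm_triangle_ineq[of "(E - E') / of_real r" "E' * of_real ((r' - r) / (r * r'))"]
    unfolding norm_mult norm_divide E' norm_of_real by (simp add: abs_mult)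
  also have "\<dots> \<le> k * d / r + d / (r * r')"
    using EE d' r by (intro add_mono divide_right_mono) auto
  finally show ?thesis by (simp add: r_def r'_def algebra_simps)
qed

text \<open>
The mixed singularity \<open>1/(r r')\<close> is split by the inequality between geometric and arithmetic mean, so
that both pieces are integrable over the cube uniformly in the positions of the poles.
\<close>

lemma green_lipschitz:
  assumes k: "k \<ge> 0" and D: "x \<in> unit_cube" "x' \<in> unit_cube" "y \<in> unit_cube" and ne: "x \<noteq> y" "x' \<noteq> y"
  shows "cmod (green k x y - green k x' y)
      \<le> (3 * k + 1) * norm (x - x') * (1 / (norm (x - y))\<^sup>2 + 1 / (norm (x' - y))\<^sup>2)"
proof -
  define r r' where "r = norm (x - y)" and "r' = norm (x' - y)"
  have r: "r > 0" "r \<le> 3" "r' > 0"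
    using ne norm_diff_unit_cube_le[OF D(1,3)] by (auto simp: r_def r'_def)
  have "cmod (green k x y - green k x' y) \<le> norm (x - x') * (k / r + 1 / (r * r'))"
    unfolding r_def r'_def
    by (rule green_diff_le[OF k ne]) (use norm_triangle_ineq3[of "x - y" "x' - y"] in simp)
  also have "\<dots> \<le> norm (x - x') * ((3 * k + 1) * (1 / r\<^sup>2 + 1 / r'\<^sup>2))"
  proof (rule mult_left_mono)
    have 1: "k / r \<le> 3 * k * (1 / r\<^sup>2)"
      using r k by (simp add: field_simps power2_eq_square) (metis mult.commute mult_left_mono)
    have "2 * ((1 / r) * (1 / r')) \<le> (1 / r)\<^sup>2 + (1 / r')\<^sup>2"
      using sum_squares_bound[of "1/r" "1/r'"] by (simp add: mult.assoc)
    then have "2 * (1 / (r * r')) \<le> 1 / r\<^sup>2 + 1 / r'\<^sup>2"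
      by (simp add: power_divide)
    moreover have "0 \<le> 1 / (r * r')" using r by simp
    ultimately have 2: "1 / (r * r') \<le> 1 / r\<^sup>2 + 1 / r'\<^sup>2"
      by (metis add_increasing2 mult_2 order_trans order_refl)
    have 3: "0 \<le> 3 * k * (1 / r'\<^sup>2)" using k by simp
    show "k / r + 1 / (r * r') \<le> (3 * k + 1) * (1 / r\<^sup>2 + 1 / r'\<^sup>2)"
    proof -
      have "a + b \<le> (3 * k + 1) * (s + t)" if "a \<le> 3 * k * s" "b \<le> s + t" "0 \<le> 3 * k * t" for a b s t :: real
        using that by (simp add: algebra_simps)
      from this[OF 1 2 3] show ?thesis .
    qed
  qed simp
  finally show ?thesis by (simp add: r_def r'_def mult_ac)
qed

lemma green_measurable [measurable]: "green k x \<in> borel_measurable borel"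
  unfolding green_def[abs_def] by measurable

text \<open>
The common estimate for potentials, their increments and quadrature errors. Increments of potentials
produce two poles, and the constant is \<open>216 + 216\<close>.
\<close>

lemma weakly_singular_integral:
  fixes f :: "real^3 \<Rightarrow> complex"
  assumes x: "x \<in> unit_cube" "x' \<in> unit_cube"
    and meas: "set_borel_measurable lborel unit_cube f"
    and bound: "AE y in lborel. y \<in> unit_cube \<longrightarrow>
                  cmod (f y) \<le> C * (1 / (norm (x - y))\<^sup>2 + 1 / (norm (x' - y))\<^sup>2)"
    and C: "C \<ge> 0"
  shows "set_integrable lborel unit_cube f"
    and "cmod (LINT y:unit_cube|lborel. f y) \<le> 432 * C"
proof -
  let ?b = "\<lambda>y. C * (1 / (norm (x - y))\<^sup>2 + 1 / (norm (x' - y))\<^sup>2)"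
  note ints = inverse_square_integrable_cube(1)[OF x(1)] inverse_square_integrable_cube(1)[OF x(2)]
  have b: "set_integrable lborel unit_cube ?b"
    by (intro set_integrable_mult_right set_integral_add ints)
  have "norm (f y) \<le> norm (?b y)" if "cmod (f y) \<le> ?b y" for y
    using that by (simp add: abs_le_iff)
  then have "AE y in lborel. y \<in> unit_cube \<longrightarrow> norm (f y) \<le> norm (?b y)"
    using bound by (auto elim!: eventually_mono)
  then show f: "set_integrable lborel unit_cube f"
    by (rule set_integrable_bound[OF b meas])
  have "cmod (LINT y:unit_cube|lborel. f y) \<le> (LINT y:unit_cube|lborel. cmod (f y))"
    by (rule set_integral_norm_bound[OF f])
  also have "\<dots> \<le> (LINT y:unit_cube|lborel. ?b y)"
    by (rule set_integral_mono_AE[OF set_integrable_norm[OF f] b]) (use bound in auto)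
  also have "\<dots> = C * ((LINT y:unit_cube|lborel. 1 / (norm (x - y))\<^sup>2) + (LINT y:unit_cube|lborel. 1 / (norm (x' - y))\<^sup>2))"
    by (simp only: set_integral_mult_right set_integral_add(2)[OF ints])
  also have "\<dots> \<le> C * (216 + 216)"
    by (intro mult_left_mono add_mono inverse_square_integrable_cube(2) x C)
  finally show "cmod (LINT y:unit_cube|lborel. f y) \<le> 432 * C" by simp
qed

section \<open>Volume potentials of bounded densities\<close>

text \<open>
The bound is required only almost everywhere because step functions over the half-open cells vanish
on the upper faces of the cube, so the difference of a density and its step function is small only off
a null set.
\<close>

definition bounded_density :: "real \<Rightarrow> (real^3 \<Rightarrow> complex) \<Rightarrow> bool" where
  "bounded_density B F \<longleftrightarrow> B \<ge> 0 \<and> set_borel_measurable lborel unit_cube F \<and> 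
     (AE y in lborel. y \<in> unit_cube \<longrightarrow> cmod (F y) \<le> B)"

lemma bounded_density_continuous:
  assumes "continuous_on unit_cube F" "\<And>y. y \<in> unit_cube \<Longrightarrow> cmod (F y) \<le> B" "B \<ge> 0"
  shows "bounded_density B F"
  using assms borel_measurable_continuous_on_indicator[OF _ assms(1)]
  by (auto simp: bounded_density_def set_borel_measurable_def)

lemma bounded_density_mult:
  assumes p: "continuous_on unit_cube p" "\<And>y. y \<in> unit_cube \<Longrightarrow> cmod (p y) \<le> Bp"
    and u: "continuous_on unit_cube u" "\<And>y. y \<in> unit_cube \<Longrightarrow> cmod (u y) \<le> Bu"
    and nonneg: "Bp \<ge> 0" "Bu \<ge> 0"
  shows "bounded_density (Bp * Bu) (\<lambda>y. p y * u y)"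
proof (rule bounded_density_continuous)
  show "continuous_on unit_cube (\<lambda>y. p y * u y)"
    by (intro continuous_on_mult p u)
  show "cmod (p y * u y) \<le> Bp * Bu" if "y \<in> unit_cube" for y
    unfolding norm_mult using that p u nonneg by (intro mult_mono) auto
qed (use nonneg in simp)

definition volume_potential :: "real \<Rightarrow> (real^3 \<Rightarrow> complex) \<Rightarrow> real^3 \<Rightarrow> complex" where
  "volume_potential k F x = (LINT y:unit_cube|lborel. green k x y * F y)"

lemma set_borel_measurable_green_mult:
  assumes "set_borel_measurable lborel unit_cube F"
  shows "set_borel_measurable lborel unit_cube (\<lambda>y. green k x y * F y)"
proof -
  have "(\<lambda>y. green k x y * (indicator unit_cube y *\<^sub>R F y)) \<in> borel_measurable lborel"
    using assms unfolding set_borel_measurable_def by measurable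
  then show ?thesis unfolding set_borel_measurable_def by simp
qed

lemma volume_potential_bound:
  assumes F: "bounded_density B F" and x: "x \<in> unit_cube"
  shows "set_integrable lborel unit_cube (\<lambda>y. green k x y * F y)"
    and "cmod (volume_potential k F x) \<le> 432 * B"
proof -
  have B: "B \<ge> 0" and meas: "set_borel_measurable lborel unit_cube F"
    and le: "AE y in lborel. y \<in> unit_cube \<longrightarrow> cmod (F y) \<le> B"
    using F by (auto simp: bounded_density_def)
  have "cmod (green k x y * F y) \<le> B * (1 / (norm (x - y))\<^sup>2 + 1 / (norm (x - y))\<^sup>2)"
    if y: "y \<in> unit_cube" and le: "cmod (F y) \<le> B" for y
  proof -
    have "cmod (green k x y * F y) \<le> (1 / (norm (x - y))\<^sup>2) * B"
      unfolding norm_mult by (intro mult_mono norm_green_le x y le) auto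
    also have "\<dots> \<le> B * (1 / (norm (x - y))\<^sup>2 + 1 / (norm (x - y))\<^sup>2)"
    proof -
      have "w * B \<le> B * (w + w)" if "w \<ge> 0" for w
        using mult_nonneg_nonneg[OF that B] by (simp add: algebra_simps)
      note le = this
      show ?thesis by (rule le) simp
    qed
    finally show ?thesis .
  qed
  with le have "AE y in lborel. y \<in> unit_cube \<longrightarrow>
      cmod (green k x y * F y) \<le> B * (1 / (norm (x - y))\<^sup>2 + 1 / (norm (x - y))\<^sup>2)"
    by (auto elim!: eventually_mono)
  from weakly_singular_integral[OF x x set_borel_measurable_green_mult[OF meas] this B]
  show "set_integrable lborel unit_cube (\<lambda>y. green k x y * F y)"
    and "cmod (volume_potential k F x) \<le> 432 * B"
    unfolding volume_potential_def .
qed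

lemma volume_potential_diff:
  assumes "bounded_density B F" "bounded_density C G" "x \<in> unit_cube"
  shows "volume_potential k (\<lambda>y. F y - G y) x = volume_potential k F x - volume_potential k G x"
  using set_integral_diff(2)[OF volume_potential_bound(1)[OF assms(1,3)] volume_potential_bound(1)[OF assms(2,3)], of k k]
  by (simp add: volume_potential_def right_diff_distrib)

lemma volume_potential_lipschitz:
  assumes F: "bounded_density B F" and k: "k \<ge> 0" and x: "x \<in> unit_cube" "x' \<in> unit_cube"
  shows "cmod (volume_potential k F x - volume_potential k F x') \<le> 432 * ((3 * k + 1) * B) * norm (x - x')"
proof -
  have B: "B \<ge> 0" and meas: "set_borel_measurable lborel unit_cube F"
    and le: "AE y in lborel. y \<in> unit_cube \<longrightarrow> cmod (F y) \<le> B"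
    using F by (auto simp: bounded_density_def)
  let ?C = "(3 * k + 1) * norm (x - x') * B"
  have ints: "set_integrable lborel unit_cube (\<lambda>y. green k x y * F y)"
    "set_integrable lborel unit_cube (\<lambda>y. green k x' y * F y)"
    using volume_potential_bound(1)[OF F] x by auto
  have eq: "volume_potential k F x - volume_potential k F x'
      = (LINT y:unit_cube|lborel. green k x y * F y - green k x' y * F y)"
    unfolding volume_potential_def by (simp only: set_integral_diff(2)[OF ints])
  have "AE y in lborel. y \<in> unit_cube \<longrightarrow> cmod (green k x y * F y - green k x' y * F y)
      \<le> ?C * (1 / (norm (x - y))\<^sup>2 + 1 / (norm (x' - y))\<^sup>2)"
    using AE_lborel_singleton[of x] AE_lborel_singleton[of x'] le
  proof eventually_elim
    case (elim y)
    show ?case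
    proof
      assume y: "y \<in> unit_cube"
      have "cmod (green k x y * F y - green k x' y * F y) = cmod (green k x y - green k x' y) * cmod (F y)"
        by (simp add: norm_mult flip: left_diff_distrib)
      also have "\<dots> \<le> ((3 * k + 1) * norm (x - x') * (1 / (norm (x - y))\<^sup>2 + 1 / (norm (x' - y))\<^sup>2)) * B"
        by (intro mult_mono green_lipschitz k x y) (use elim k y in auto)
      finally show "cmod (green k x y * F y - green k x' y * F y)
        \<le> ?C * (1 / (norm (x - y))\<^sup>2 + 1 / (norm (x' - y))\<^sup>2)" by (simp add: mult_ac)
    qed
  qed
  from weakly_singular_integral(2)[OF x set_integral_diff(1)[OF ints, unfolded set_integrable_def, THEN borel_measurable_integrable, folded set_borel_measurable_def] this]
  show ?thesis unfolding eq using k B by (simp add: mult_ac)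
qed

section \<open>The partition into cubes and step functions\<close>

text \<open>
Half-open cells are disjoint, so exactly one summand of a step function is nonzero at a given point.
\<close>

definition cell :: "nat \<Rightarrow> real^3 \<Rightarrow> (real^3) set" where
  "cell n z = {y. \<forall>i. z $ i - 1 / (2 * real n) \<le> y $ i \<and> y $ i < z $ i + 1 / (2 * real n)}"

definition step_fun :: "nat \<Rightarrow> (real^3 \<Rightarrow> complex) \<Rightarrow> real^3 \<Rightarrow> complex" where
  "step_fun n F y = (\<Sum>z\<in>cube_centers n. indicator (cell n z) y *\<^sub>R F z)"

lemma finite_cube_centers: "finite (cube_centers n)"
proof -
  have "finite (vec_nth -` (UNIV \<rightarrow>\<^sub>E {..<n}) :: (nat^3) set)"
    by (intro finite_vimageI finite_PiE) (auto simp: inj_def vec_eq_iff)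
  moreover have "{q::nat^3. \<forall>i. q $ i < n} = vec_nth -` (UNIV \<rightarrow>\<^sub>E {..<n})"
    by (auto simp: PiE_def Pi_def)
  ultimately have "finite {q::nat^3. \<forall>i. q $ i < n}" by simp
  then show ?thesis
    unfolding cube_centers_def by simp
qed

lemma cube_centersE:
  assumes "z \<in> cube_centers n"
  obtains q :: "nat^3" where "\<And>i. q $ i < n" "\<And>i. z $ i = (real (q $ i) + 1 / 2) / real n"
proof -
  obtain q :: "nat^3" where "z = (\<chi> i. (real (q $ i) + 1 / 2) / real n)" "\<forall>i. q $ i < n"
    using assms unfolding cube_centers_def by blast
  then show thesis by (intro that[of q]) auto
qed

text \<open>
A point of the cell determines the integer index of that cell as \<open>\<lfloor>n y\<^sub>i\<rfloor>\<close>; disjointness of the cells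
and their inclusion in the unit cube both follow from this.
\<close>

lemma cell_index:
  assumes n: "n > 0" and z: "z $ i = (real q + 1 / 2) / real n" and y: "y \<in> cell n z"
  shows "real q \<le> real n * y $ i" "real n * y $ i < real q + 1"
proof -
  have "real q / real n \<le> y $ i" "y $ i < (real q + 1) / real n"
    using y[unfolded cell_def, simplified, THEN spec, of i] n unfolding z by (auto simp: field_simps)
  then show "real q \<le> real n * y $ i" "real n * y $ i < real q + 1"
    using n by (auto simp: field_simps)
qed

lemma cube_center_in_cell: "n > 0 \<Longrightarrow> z \<in> cell n z"
  by (auto simp: cell_def)

lemma cell_subset_unit_cube:
  assumes n: "n > 0" and z: "z \<in> cube_centers n"
  shows "cell n z \<subseteq> unit_cube"
proof
  fix y assume y: "y \<in> cell n z"
  obtain q :: "nat^3" where q: "\<And>i. q $ i < n" "\<And>i. z $ i = (real (q $ i) + 1 / 2) / real n"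
    using cube_centersE[OF z] by blast
  have "0 \<le> y $ i \<and> y $ i \<le> 1" for i
  proof -
    have qn: "real (q $ i) + 1 \<le> real n"
      using q(1)[of i] by linarith
    have "0 \<le> real n * y $ i" "real n * y $ i \<le> real n * 1"
      using cell_index[OF n q(2)[of i] y] qn by linarith+
    then show ?thesis using n by (simp add: zero_le_mult_iff)
  qed
  then show "y \<in> unit_cube" by (simp add: mem_box_cart)
qed

lemma cube_centers_subset: "n > 0 \<Longrightarrow> z \<in> cube_centers n \<Longrightarrow> z \<in> unit_cube"
  using cell_subset_unit_cube cube_center_in_cell by blast

lemma cell_unique:
  assumes n: "n > 0" and z: "z \<in> cube_centers n" "z' \<in> cube_centers n"
    and y: "y \<in> cell n z" "y \<in> cell n z'"
  shows "z = z'"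
proof -
  obtain q :: "nat^3" where q: "\<And>i. z $ i = (real (q $ i) + 1 / 2) / real n"
    using cube_centersE[OF z(1)] by metis
  obtain q' :: "nat^3" where q': "\<And>i. z' $ i = (real (q' $ i) + 1 / 2) / real n"
    using cube_centersE[OF z(2)] by metis
  have "q $ i = q' $ i" for i
    using cell_index[OF n q[of i] y(1)] cell_index[OF n q'[of i] y(2)] by linarith
  then show ?thesis using q q' by (simp add: vec_eq_iff)
qed

lemma cell_cover:
  assumes n: "n > 0" and y: "\<And>i. 0 \<le> y $ i \<and> y $ i < 1"
  obtains z where "z \<in> cube_centers n" "y \<in> cell n z"
proof -
  define q :: "nat^3" where "q = (\<chi> i. nat \<lfloor>real n * y $ i\<rfloor>)"
  define z :: "real^3" where "z = (\<chi> i. (real (q $ i) + 1 / 2) / real n)"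
  have q: "real (q $ i) \<le> real n * y $ i" "real n * y $ i < real (q $ i) + 1" for i
    using y[of i] by (auto simp: q_def)
  have "real (q $ i) < real n" for i
    by (rule le_less_trans[OF q(1)]) (use y[of i] n in simp)
  then have "z \<in> cube_centers n"
    unfolding cube_centers_def z_def by auto
  moreover have "y \<in> cell n z"
  proof -
    have "z $ i - 1 / (2 * real n) = real (q $ i) / real n"
      "z $ i + 1 / (2 * real n) = (real (q $ i) + 1) / real n" for i
      using n by (auto simp: z_def field_simps)
    moreover have "real (q $ i) / real n \<le> y $ i" "y $ i < (real (q $ i) + 1) / real n" for i
      using q[of i] n by (simp_all add: divide_le_eq less_divide_eq mult.commute)
    ultimately show ?thesis by (simp add: cell_def)
  qed
  ultimately show thesis by (rule that)
qed

text \<open>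
The constant matters: \<open>\<surd>3 / (2 n)\<close> is below \<open>1/n\<close>, so the oscillation of \<open>p\<close> over a cell is controlled
by its modulus of continuity at \<open>1/n\<close> itself.
\<close>

lemma cell_diameter:
  assumes n: "n > 0" and y: "y \<in> cell n z"
  shows "norm (y - z) \<le> 1 / real n"
proof -
  have "\<bar>(y - z) $ i\<bar> \<le> 1 / (2 * real n)" for i
    using y[unfolded cell_def, simplified, THEN spec, of i] by (simp add: abs_le_iff)
  then have "((y - z) $ i)\<^sup>2 \<le> (1 / (2 * real n))\<^sup>2" for i
    by (metis abs_le_square_iff abs_of_nonneg divide_nonneg_nonneg mult_nonneg_nonneg of_nat_0_le_iff zero_le_numeral zero_le_one)
  then have "(\<Sum>i\<in>UNIV. ((y - z) $ i)\<^sup>2) \<le> (\<Sum>i\<in>(UNIV::3 set). (1 / (2 * real n))\<^sup>2)"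
    by (intro sum_mono)
  also have "\<dots> \<le> (1 / real n)\<^sup>2"
    using n by (simp add: power_divide power_mult_distrib divide_simps)
  finally have "sqrt (\<Sum>i\<in>UNIV. ((y - z) $ i)\<^sup>2) \<le> sqrt ((1 / real n)\<^sup>2)"
    by (rule real_sqrt_le_mono)
  moreover have "sqrt ((1 / real n)\<^sup>2) = 1 / real n"
    by (simp only: real_sqrt_abs) simp
  moreover have "norm (y - z) = sqrt (\<Sum>i\<in>UNIV. ((y - z) $ i)\<^sup>2)"
    by (simp add: norm_vec_def L2_set_def)
  ultimately show ?thesis by simp
qed

lemma cube_centers_separated:
  assumes n: "n > 0" and z: "z \<in> cube_centers n" "z' \<in> cube_centers n" "z \<noteq> z'"
  shows "1 / real n \<le> norm (z - z')"
proof -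
  obtain q :: "nat^3" where q: "\<And>i. z $ i = (real (q $ i) + 1 / 2) / real n"
    using cube_centersE[OF z(1)] by metis
  obtain q' :: "nat^3" where q': "\<And>i. z' $ i = (real (q' $ i) + 1 / 2) / real n"
    using cube_centersE[OF z(2)] by metis
  obtain i where "q $ i \<noteq> q' $ i"
    using z(3) q q' by (auto simp: vec_eq_iff)
  then have "1 \<le> \<bar>real (q $ i) - real (q' $ i)\<bar>" by linarith
  then have "1 / real n \<le> \<bar>real (q $ i) - real (q' $ i)\<bar> / real n"
    by (intro divide_right_mono) auto
  also have "\<dots> = \<bar>(z - z') $ i\<bar>"
    using n by (simp add: q q' diff_divide_distrib[symmetric] del: diff_divide_distrib)
  also have "\<dots> \<le> norm (z - z')" by (rule component_le_norm_cart)
  finally show ?thesis .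
qed

lemma cell_measurable [measurable]: "cell n z \<in> sets borel"
  unfolding cell_def by measurable

text \<open>
The cell lies between an open and a closed box of the same volume.
\<close>

lemma emeasure_cell:
  assumes n: "n > 0"
  shows "emeasure lborel (cell n z) = ennreal (1 / real n ^ 3)"
proof (rule antisym)
  define d :: "real^3" where "d = (\<chi> i. 1 / (2 * real n))"
  have len: "(\<Prod>b\<in>Basis. ((z + d) - (z - d)) \<bullet> b) = 1 / real n ^ 3"
  proof -
    have "((z + d) - (z - d)) \<bullet> b = 1 / real n" if "b \<in> Basis" for b
      using that n by (auto simp: Basis_vec_def inner_axis d_def field_simps)
    then have "(\<Prod>b\<in>Basis. ((z + d) - (z - d)) \<bullet> b) = (\<Prod>b\<in>(Basis::(real^3) set). 1 / real n)"
      by (intro prod.cong) auto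
    then show ?thesis by (simp add: power_divide)
  qed
  have le: "(z - d) \<bullet> b \<le> (z + d) \<bullet> b" if "b \<in> Basis" for b
    using that by (auto simp: Basis_vec_def inner_axis d_def)
  have "emeasure lborel (cell n z) \<le> emeasure lborel (cbox (z - d) (z + d))"
  proof (intro emeasure_mono subsetI)
    fix y assume "y \<in> cell n z"
    then show "y \<in> cbox (z - d) (z + d)"
      by (simp add: cell_def mem_box_cart d_def less_imp_le)
  qed simp
  then show "emeasure lborel (cell n z) \<le> ennreal (1 / real n ^ 3)"
    using le len by simp
  have "emeasure lborel (box (z - d) (z + d)) \<le> emeasure lborel (cell n z)"
    by (intro emeasure_mono) (auto simp: cell_def mem_box_cart d_def intro: less_imp_le)
  then show "ennreal (1 / real n ^ 3) \<le> emeasure lborel (cell n z)"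
    using le len by simp
qed

lemma AE_half_open_cube:
  "AE y in lborel. y \<in> unit_cube \<longrightarrow> (\<forall>i::3. 0 \<le> y $ i \<and> y $ i < 1)"
proof -
  have one: "(1::real^3) \<bullet> b = 1" if "b \<in> Basis" for b
    using that by (auto simp: Basis_vec_def inner_axis)
  have "emeasure lborel (unit_cube - box 0 1) = emeasure lborel unit_cube - emeasure lborel (box 0 (1::real^3))"
    using one by (intro emeasure_Diff) (auto simp: box_subset_cbox emeasure_lborel_box_eq)
  also have "\<dots> = 0" using one by simp
  finally have "unit_cube - box 0 1 \<in> null_sets lborel" by (simp add: null_sets_def)
  then have "AE y in lborel. y \<notin> unit_cube - box 0 (1::real^3)" by (rule AE_not_in)
  then show ?thesis
    by eventually_elim (auto simp: mem_box_cart less_imp_le)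
qed

lemma step_fun_eq:
  assumes "n > 0" "z \<in> cube_centers n" "y \<in> cell n z"
  shows "step_fun n F y = F z"
proof -
  have "step_fun n F y = (\<Sum>w\<in>cube_centers n. if w = z then F z else 0)"
    unfolding step_fun_def
    by (intro sum.cong) (use assms cell_unique in \<open>auto simp: indicator_def\<close>)
  then show ?thesis using assms finite_cube_centers by simp
qed

text \<open>
This is the form in which the partition is used: almost every point of the cube lies in the
cell of a center \<open>z\<close>, and there all step functions take their value at \<open>z\<close> simultaneously.
\<close>

lemma AE_cell:
  assumes n: "n > 0"
  shows "AE y in lborel. y \<in> unit_cube \<longrightarrow>
     (\<exists>z\<in>cube_centers n. y \<in> cell n z \<and> norm (y - z) \<le> 1 / real n \<and> (\<forall>F. step_fun n F y = F z))"
  using AE_half_open_cube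
proof eventually_elim
  case (elim y)
  show ?case
  proof
    assume "y \<in> unit_cube"
    with elim obtain z where "z \<in> cube_centers n" "y \<in> cell n z"
      using cell_cover[OF n] by metis
    then show "\<exists>z\<in>cube_centers n. y \<in> cell n z \<and> norm (y - z) \<le> 1 / real n \<and> (\<forall>F. step_fun n F y = F z)"
      using cell_diameter[OF n] step_fun_eq[OF n] by blast
  qed
qed

lemma step_fun_measurable [measurable]: "step_fun n F \<in> borel_measurable borel"
  unfolding step_fun_def[abs_def] by measurable

lemma set_borel_measurable_step_fun: "set_borel_measurable lborel unit_cube (step_fun n F)"
  unfolding set_borel_measurable_def by measurable

lemma norm_step_fun_le:
  assumes n: "n > 0" and B: "B \<ge> 0" and F: "\<And>z. z \<in> cube_centers n \<Longrightarrow> cmod (F z) \<le> B"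
  shows "cmod (step_fun n F y) \<le> B"
proof (cases "\<exists>z\<in>cube_centers n. y \<in> cell n z")
  case True
  then show ?thesis using step_fun_eq[OF n] F by metis
next
  case False
  then show ?thesis using B by (simp add: step_fun_def)
qed

lemma bounded_density_step_fun:
  assumes "n > 0" "B \<ge> 0" "\<And>z. z \<in> cube_centers n \<Longrightarrow> cmod (F z) \<le> B"
  shows "bounded_density B (step_fun n F)"
  using norm_step_fun_le[OF assms] assms(2)
  by (simp add: bounded_density_def set_borel_measurable_step_fun)

lemma integral_step_fun:
  assumes n: "n > 0"
  shows "set_integrable lborel unit_cube (step_fun n F)"
    and "(LINT y:unit_cube|lborel. step_fun n F y) = (\<Sum>z\<in>cube_centers n. F z) / of_nat n ^ 3"
proof -
  have cell_int: "integrable lborel (\<lambda>y. indicator (cell n z) y *\<^sub>R F z)" for z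
    by (rule integrable_scaleR_left) (simp add: emeasure_cell[OF n])
  have eq: "indicator unit_cube y *\<^sub>R step_fun n F y = step_fun n F y" for y
  proof (cases "y \<in> unit_cube")
    case False
    then have "step_fun n F y = 0"
      unfolding step_fun_def using cell_subset_unit_cube[OF n]
      by (intro sum.neutral) (auto simp: indicator_def)
    then show ?thesis by simp
  qed simp
  show "set_integrable lborel unit_cube (step_fun n F)"
    unfolding set_integrable_def eq unfolding step_fun_def
    by (intro Bochner_Integration.integrable_sum cell_int)
  have "(LINT y:unit_cube|lborel. step_fun n F y)
      = (\<Sum>z\<in>cube_centers n. LINT y|lborel. indicator (cell n z) y *\<^sub>R F z)"
    unfolding set_lebesgue_integral_def eq unfolding step_fun_def
    by (intro Bochner_Integration.integral_sum cell_int)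
  also have "\<dots> = (\<Sum>z\<in>cube_centers n. (1 / real n ^ 3) *\<^sub>R F z)"
    by (intro sum.cong) (auto simp: measure_def emeasure_cell[OF n])
  also have "\<dots> = (\<Sum>z\<in>cube_centers n. F z) / of_nat n ^ 3"
    by (simp add: scaleR_conv_of_real sum_divide_distrib)
  finally show "(LINT y:unit_cube|lborel. step_fun n F y) = (\<Sum>z\<in>cube_centers n. F z) / of_nat n ^ 3" .
qed

section \<open>Quadrature and consistency\<close>

text \<open>
The midpoint rule for the volume potential. The sum includes the center \<open>z = x\<close>, where the Green
function is 0, so for centers \<open>x\<close> the self-interaction is excluded.
\<close>

definition discrete_potential :: "real \<Rightarrow> nat \<Rightarrow> (real^3 \<Rightarrow> complex) \<Rightarrow> real^3 \<Rightarrow> complex" where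
  "discrete_potential k n F x = (\<Sum>z\<in>cube_centers n. green k x z * F z) / of_nat n ^ 3"

lemma discrete_potential_cmult:
  "discrete_potential k n (\<lambda>z. c * F z) x = c * discrete_potential k n F x"
  by (simp add: discrete_potential_def sum_distrib_left mult_ac)

lemma discrete_potential_diff:
  "discrete_potential k n (\<lambda>z. F z - G z) x = discrete_potential k n F x - discrete_potential k n G x"
  by (simp add: discrete_potential_def right_diff_distrib sum_subtractf diff_divide_distrib)

text \<open>
If \<open>z\<close> differs from \<open>x\<close>, then \<open>|x - z|\<close> is at least \<open>1/n\<close>, hence \<open>|x - y| \<le> 2 |x - z|\<close>, and the
singularity at \<open>z\<close> is controlled by the one at \<open>y\<close>. If \<open>z = x\<close>, the subtracted value is 0, and the
smallness comes from \<open>|x - y| \<le> 1/n\<close> instead, which turns \<open>1/r\<close> into \<open>(1/n) / r\<^sup>2\<close>.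
\<close>

lemma green_cell_diff_le:
  assumes k: "k \<ge> 0" and n: "n > 0" and x: "x \<in> cube_centers n" and z: "z \<in> cube_centers n"
    and y: "y \<in> cell n z" and ne: "y \<noteq> x"
  shows "cmod (green k x y - green k x z) \<le> (3 * k + 2) / real n * (1 / (norm (x - y))\<^sup>2)"
proof -
  define r where "r = norm (x - y)"
  have yD: "y \<in> unit_cube" and xD: "x \<in> unit_cube"
    using cell_subset_unit_cube[OF n z] y cube_centers_subset[OF n x] by auto
  have r: "0 < r" "r \<le> 3"
    using ne norm_diff_unit_cube_le[OF xD yD] by (auto simp: r_def)
  have yz: "norm (y - z) \<le> 1 / real n" by (rule cell_diameter[OF n y])
  have inv_r: "1 / r \<le> 3 * (1 / r\<^sup>2)"
    using r by (simp add: field_simps power2_eq_square)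
  show ?thesis
  proof (cases "x = z")
    case True
    have rn: "r \<le> 1 / real n" using yz True by (simp add: r_def norm_minus_commute)
    have "cmod (green k x y - green k x z) = 1 / (4 * pi * r)"
      using True by (simp add: norm_green r_def)
    also have "\<dots> \<le> 1 / r"
      using r pi_gt3 by (intro divide_left_mono) auto
    also have "\<dots> = r * (1 / r\<^sup>2)"
      using r by (simp add: power2_eq_square)
    also have "\<dots> \<le> (3 * k + 2) / real n * (1 / r\<^sup>2)"
    proof (rule mult_right_mono)
      have "1 / real n \<le> (3 * k + 2) / real n"
        using k by (intro divide_right_mono) auto
      then show "r \<le> (3 * k + 2) / real n" using rn by linarith
    qed simp
    finally show ?thesis by (simp add: r_def)
  next
    case False
    define r' where "r' = norm (x - z)"
    have r': "1 / real n \<le> r'" unfolding r'_def by (rule cube_centers_separated[OF n x z False])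
    have r'0: "r' > 0" using r' n by (simp add: less_le_trans[OF _ r'])
    have "\<bar>r - r'\<bar> \<le> norm (y - z)"
      using norm_triangle_ineq3[of "x - y" "x - z"] by (simp add: r_def r'_def norm_minus_commute)
    then have d: "\<bar>r - r'\<bar> \<le> 1 / real n" using yz by linarith
    then have r2: "r \<le> 2 * r'" using r' by linarith
    have "cmod (green k x y - green k x z) \<le> 1 / real n * (k / r + 1 / (r * r'))"
      unfolding r_def r'_def
      by (rule green_diff_le[OF k]) (use ne False d in \<open>auto simp: r_def r'_def\<close>)
    also have "\<dots> \<le> 1 / real n * ((3 * k + 2) * (1 / r\<^sup>2))"
    proof (rule mult_left_mono)
      have "k / r \<le> 3 * k * (1 / r\<^sup>2)"
        using mult_left_mono[OF inv_r k] by (simp add: mult_ac)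
      moreover have "1 / (r * r') \<le> 2 * (1 / r\<^sup>2)"
        using r r'0 r2 by (simp add: field_simps power2_eq_square)
      moreover have "a + b \<le> (3 * k + 2) * s" if "a \<le> 3 * k * s" "b \<le> 2 * s" for a b s :: real
        using that by (simp add: algebra_simps)
      ultimately show "k / r + 1 / (r * r') \<le> (3 * k + 2) * (1 / r\<^sup>2)" by blast
    qed simp
    finally show ?thesis by (simp add: r_def)
  qed
qed

text \<open>
The midpoint sum is the integral of the step function with the values \<open>g(x,z) F(z)\<close>. Therefore the
difference is an integral of \<open>(g(x,y) - g(x,z)) F(z)\<close> with \<open>z\<close> the center of the cell of \<open>y\<close>.
\<close>

lemma discrete_potential_quadrature:
  assumes k: "k \<ge> 0" and n: "n > 0" and x: "x \<in> cube_centers n"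
    and B: "B \<ge> 0" and F: "\<And>z. z \<in> cube_centers n \<Longrightarrow> cmod (F z) \<le> B"
  shows "cmod (volume_potential k (step_fun n F) x - discrete_potential k n F x)
      \<le> 432 * ((3 * k + 2) * B) / real n"
proof -
  have xD: "x \<in> unit_cube" by (rule cube_centers_subset[OF n x])
  note int1 = volume_potential_bound(1)[where k = k, OF bounded_density_step_fun[OF n B F] xD]
  note int2 = integral_step_fun(1)[OF n, of "\<lambda>z. green k x z * F z"]
  let ?C = "(3 * k + 2) * B / real n"
  have eq: "volume_potential k (step_fun n F) x - discrete_potential k n F x
     = (LINT y:unit_cube|lborel. green k x y * step_fun n F y - step_fun n (\<lambda>z. green k x z * F z) y)"
    unfolding volume_potential_def discrete_potential_def integral_step_fun(2)[OF n, symmetric]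
    by (rule set_integral_diff(2)[OF int1 int2, symmetric])
  have "AE y in lborel. y \<in> unit_cube \<longrightarrow>
     cmod (green k x y * step_fun n F y - step_fun n (\<lambda>z. green k x z * F z) y)
       \<le> ?C * (1 / (norm (x - y))\<^sup>2 + 1 / (norm (x - y))\<^sup>2)"
    using AE_cell[OF n] AE_lborel_singleton[of x]
  proof eventually_elim
    case (elim y)
    show ?case
    proof
      assume "y \<in> unit_cube"
      with elim obtain z where z: "z \<in> cube_centers n" "y \<in> cell n z" "\<And>F. step_fun n F y = F z"
        by blast
      have "cmod (green k x y * step_fun n F y - step_fun n (\<lambda>z. green k x z * F z) y)
          = cmod (green k x y - green k x z) * cmod (F z)"
        by (simp add: z(3) norm_mult flip: left_diff_distrib)
      also have "\<dots> \<le> ((3 * k + 2) / real n * (1 / (norm (x - y))\<^sup>2)) * B"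
        by (intro mult_mono green_cell_diff_le k n x z F) (use elim k in auto)
      also have "\<dots> = ?C * (1 / (norm (x - y))\<^sup>2)" by simp
      also have "\<dots> \<le> ?C * (1 / (norm (x - y))\<^sup>2 + 1 / (norm (x - y))\<^sup>2)"
        using k B by (intro mult_left_mono add_increasing2 order_refl) auto
      finally show "cmod (green k x y * step_fun n F y - step_fun n (\<lambda>z. green k x z * F z) y)
          \<le> ?C * (1 / (norm (x - y))\<^sup>2 + 1 / (norm (x - y))\<^sup>2)" .
    qed
  qed
  from weakly_singular_integral(2)[OF xD xD _ this]
  show ?thesis unfolding eq
    using set_integral_diff(1)[OF int1 int2] k B
    by (simp add: set_integrable_def set_borel_measurable_def borel_measurable_integrable)
qed

lemma discrete_potential_bound:
  assumes k: "k \<ge> 0" and n: "n > 0" and x: "x \<in> cube_centers n"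
    and B: "B \<ge> 0" and F: "\<And>z. z \<in> cube_centers n \<Longrightarrow> cmod (F z) \<le> B"
  shows "cmod (discrete_potential k n F x) \<le> 432 * ((3 * k + 3) * B)"
proof -
  have xD: "x \<in> unit_cube" by (rule cube_centers_subset[OF n x])
  have "cmod (volume_potential k (step_fun n F) x - discrete_potential k n F x)
      \<le> 432 * ((3 * k + 2) * B) / real n"
    by (rule discrete_potential_quadrature[OF k n x B F])
  also have "\<dots> \<le> 432 * ((3 * k + 2) * B) / 1"
    using n k B by (intro divide_left_mono) auto
  finally have 1: "cmod (volume_potential k (step_fun n F) x - discrete_potential k n F x)
      \<le> 432 * ((3 * k + 2) * B)" by simp
  have 2: "cmod (volume_potential k (step_fun n F) x) \<le> 432 * B"
    by (rule volume_potential_bound(2)[OF bounded_density_step_fun[OF n B F] xD])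
  have "cmod (discrete_potential k n F x) \<le> 432 * ((3 * k + 2) * B) + 432 * B"
    using 1 2 norm_triangle_sub[of "discrete_potential k n F x" "volume_potential k (step_fun n F) x"]
    by (simp add: norm_minus_commute)
  also have "\<dots> = 432 * ((3 * k + 3) * B)" by (simp add: algebra_simps)
  finally show ?thesis .
qed

text \<open>
Three errors are added: replacing the density \<open>p u\<close> by its step function, replacing the potential of
the step function by the midpoint sum, and the factor \<open>s\<close>.
\<close>

lemma discrete_potential_consistency:
  assumes k: "k \<ge> 0" and n: "n > 0" and x: "x \<in> cube_centers n"
    and p: "continuous_on unit_cube p" "\<And>y. y \<in> unit_cube \<Longrightarrow> cmod (p y) \<le> Bp"
    and u: "continuous_on unit_cube u" "\<And>y. y \<in> unit_cube \<Longrightarrow> cmod (u y) \<le> Bu"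
    and nonneg: "Bp \<ge> 0" "Bu \<ge> 0" "L \<ge> 0" "w \<ge> 0"
    and lip: "\<And>y z. y \<in> unit_cube \<Longrightarrow> z \<in> unit_cube \<Longrightarrow> cmod (u y - u z) \<le> L * norm (y - z)"
    and osc: "\<And>y z. y \<in> unit_cube \<Longrightarrow> z \<in> unit_cube \<Longrightarrow> norm (y - z) \<le> 1 / real n \<Longrightarrow> cmod (p y - p z) \<le> w"
  shows "cmod (volume_potential k (\<lambda>y. p y * u y) x - of_real s * discrete_potential k n (\<lambda>y. p y * u y) x)
     \<le> 432 * (w * Bu + Bp * L / real n) + 432 * ((3 * k + 2) * (Bp * Bu)) / real n
        + \<bar>1 - s\<bar> * (432 * ((3 * k + 3) * (Bp * Bu)))"
proof -
  define F where "F y = p y * u y" for y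
  have xD: "x \<in> unit_cube" by (rule cube_centers_subset[OF n x])
  have Fc: "continuous_on unit_cube F"
    unfolding F_def by (intro continuous_intros p u)
  have Fb: "cmod (F y) \<le> Bp * Bu" if "y \<in> unit_cube" for y
    unfolding F_def norm_mult using that by (intro mult_mono p u nonneg) auto
  have B0: "0 \<le> Bp * Bu" using nonneg by simp
  have Fz: "cmod (F z) \<le> Bp * Bu" if "z \<in> cube_centers n" for z
    using that by (intro Fb cube_centers_subset[OF n])
  note bF = bounded_density_continuous[OF Fc Fb B0]
  note bS = bounded_density_step_fun[OF n B0 Fz]
  have AEd: "AE y in lborel. y \<in> unit_cube \<longrightarrow> cmod (F y - step_fun n F y) \<le> w * Bu + Bp * L / real n"
    using AE_cell[OF n]
  proof eventually_elim
    case (elim y)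
    show ?case
    proof
      assume y: "y \<in> unit_cube"
      with elim obtain z where z: "z \<in> cube_centers n" "norm (y - z) \<le> 1 / real n" "\<And>F. step_fun n F y = F z"
        by blast
      have zD: "z \<in> unit_cube" by (rule cube_centers_subset[OF n z(1)])
      have "cmod (F y - step_fun n F y) = cmod ((p y - p z) * u y + p z * (u y - u z))"
        by (simp add: z(3) F_def algebra_simps)
      also have "\<dots> \<le> cmod (p y - p z) * cmod (u y) + cmod (p z) * cmod (u y - u z)"
        using norm_triangle_ineq[of "(p y - p z) * u y" "p z * (u y - u z)"] by (simp add: norm_mult)
      also have "\<dots> \<le> w * Bu + Bp * (L * (1 / real n))"
      proof (intro add_mono mult_mono)
        show "cmod (u y - u z) \<le> L * (1 / real n)"
          using lip[OF y zD] mult_left_mono[OF z(2) nonneg(3)] by linarith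
      qed (use osc[OF y zD z(2)] u(2)[OF y] p(2)[OF zD] nonneg in auto)
      finally show "cmod (F y - step_fun n F y) \<le> w * Bu + Bp * L / real n" by simp
    qed
  qed
  have dens: "bounded_density (w * Bu + Bp * L / real n) (\<lambda>y. F y - step_fun n F y)"
  proof -
    have "set_borel_measurable lborel unit_cube (\<lambda>y. F y - step_fun n F y)"
      using bF set_borel_measurable_step_fun[of n F]
      by (auto simp: bounded_density_def set_borel_measurable_def scaleR_diff_right
          intro!: borel_measurable_diff)
    then show ?thesis using AEd nonneg by (simp add: bounded_density_def)
  qed
  have 1: "cmod (volume_potential k F x - volume_potential k (step_fun n F) x) \<le> 432 * (w * Bu + Bp * L / real n)"
    using volume_potential_bound(2)[where k = k, OF dens xD] volume_potential_diff[where k = k, OF bF bS xD] by simp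
  have 2: "cmod (volume_potential k (step_fun n F) x - discrete_potential k n F x)
      \<le> 432 * ((3 * k + 2) * (Bp * Bu)) / real n"
    by (rule discrete_potential_quadrature[OF k n x B0 Fz])
  have "cmod (of_real (1 - s) * discrete_potential k n F x) \<le> \<bar>1 - s\<bar> * (432 * ((3 * k + 3) * (Bp * Bu)))"
    unfolding norm_mult norm_of_real
    by (intro mult_left_mono discrete_potential_bound[OF k n x B0 Fz]) auto
  then have 3: "cmod (discrete_potential k n F x - of_real s * discrete_potential k n F x)
      \<le> \<bar>1 - s\<bar> * (432 * ((3 * k + 3) * (Bp * Bu)))"
    by (simp add: algebra_simps)
  have "cmod (volume_potential k F x - of_real s * discrete_potential k n F x)
     \<le> 432 * (w * Bu + Bp * L / real n) + 432 * ((3 * k + 2) * (Bp * Bu)) / real n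
        + \<bar>1 - s\<bar> * (432 * ((3 * k + 3) * (Bp * Bu)))"
    by (rule norm_diff_triangle_le[OF norm_diff_triangle_le[OF 1 2] 3])
  then show ?thesis by (simp add: F_def[abs_def])
qed

section \<open>Stability of the discrete problem\<close>

text \<open>
The compactness argument behind stability. Grid functions bounded by 1 with residuals tending to 0
subconverge to a solution of the homogeneous integral equation. As that solution vanishes, the grid
functions become uniformly small.
\<close>

lemma discrete_homogeneous_limit:
  fixes n :: "nat \<Rightarrow> nat" and s r :: "nat \<Rightarrow> real" and e :: "nat \<Rightarrow> real^3 \<Rightarrow> complex"
  assumes k: "k \<ge> 0" and p: "continuous_on unit_cube p"
    and inj: "\<forall>w. continuous_on unit_cube w \<longrightarrow>
       (\<forall>x\<in>unit_cube. w x + volume_potential k (\<lambda>y. p y * w y) x = 0) \<longrightarrow> (\<forall>x\<in>unit_cube. w x = 0)"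
    and n: "\<And>i. n i > 0" "filterlim n at_top sequentially" and s: "s \<longlonglongrightarrow> 1" and r: "r \<longlonglongrightarrow> 0"
    and e: "\<And>i z. z \<in> cube_centers (n i) \<Longrightarrow> cmod (e i z) \<le> 1"
    and res: "\<And>i x. x \<in> cube_centers (n i) \<Longrightarrow>
       cmod (e i x + of_real (s i) * discrete_potential k (n i) (\<lambda>z. p z * e i z) x) \<le> r i"
  shows "\<exists>i. \<forall>x\<in>cube_centers (n i). cmod (e i x) < 1"
proof -
  obtain Bp where Bp: "Bp > 0" "\<And>y. y \<in> unit_cube \<Longrightarrow> cmod (p y) \<le> Bp"
    using compact_imp_bounded[OF compact_continuous_image[OF p compact_cbox]]
    by (auto simp: bounded_pos)
  obtain S where S: "S > 0" "\<And>i. \<bar>s i\<bar> \<le> S"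
    using convergent_imp_Bseq[OF convergentI[OF s]] by (auto simp: Bseq_def)
  define B where "B = S * Bp"
  have B0: "B \<ge> 0" using S Bp by (simp add: B_def)
  define F where "F i z = of_real (s i) * (p z * e i z)" for i z
  have F: "cmod (F i z) \<le> B" if z: "z \<in> cube_centers (n i)" for i z
  proof -
    have "\<bar>s i\<bar> * (cmod (p z) * cmod (e i z)) \<le> S * (Bp * 1)"
      using S Bp e[OF z] cube_centers_subset[OF n(1) z] by (intro mult_mono) auto
    then show ?thesis by (simp add: F_def B_def norm_mult)
  qed
  note bF = bounded_density_step_fun[OF n(1) B0 F]
  define W where "W i = volume_potential k (step_fun (n i) (F i))" for i
  have Wb: "cmod (W i x) \<le> 432 * B" if "x \<in> unit_cube" for i x
    unfolding W_def by (rule volume_potential_bound(2)[OF bF that])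
  define L where "L = 432 * ((3 * k + 1) * B)"
  have L0: "L \<ge> 0" using k B0 by (simp add: L_def)
  have Wl: "cmod (W i x - W i y) \<le> L * norm (x - y)" if "x \<in> unit_cube" "y \<in> unit_cube" for i x y
    unfolding W_def L_def by (rule volume_potential_lipschitz[OF bF k that])
  have equi: "\<exists>d. 0 < d \<and> (\<forall>i y. y \<in> unit_cube \<and> norm (x - y) < d \<longrightarrow> cmod (W i x - W i y) < \<epsilon>)"
    if x: "x \<in> unit_cube" and "0 < \<epsilon>" for x \<epsilon>
  proof (intro exI[of _ "\<epsilon> / (L + 1)"] conjI allI impI)
    show "0 < \<epsilon> / (L + 1)" using \<open>0 < \<epsilon>\<close> L0 by simp
    fix i y assume y: "y \<in> unit_cube \<and> norm (x - y) < \<epsilon> / (L + 1)"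
    have "cmod (W i x - W i y) \<le> L * norm (x - y)" using Wl x y by blast
    also have "\<dots> \<le> (L + 1) * norm (x - y)" by (intro mult_right_mono) auto
    also have "\<dots> < \<epsilon>" using y L0 by (simp add: pos_less_divide_eq mult.commute)
    finally show "cmod (W i x - W i y) < \<epsilon>" .
  qed
  obtain w and \<sigma> :: "nat \<Rightarrow> nat" where w: "continuous_on unit_cube w" and \<sigma>: "strict_mono \<sigma>"
    and lim: "\<And>\<epsilon>. 0 < \<epsilon> \<Longrightarrow> \<exists>N. \<forall>i x. i \<ge> N \<and> x \<in> unit_cube \<longrightarrow> cmod (W (\<sigma> i) x - w x) < \<epsilon>"
  proof (rule Arzela_Ascoli[of unit_cube W "432 * B"])
    show "compact (unit_cube :: (real^3) set)" by (rule compact_cbox)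
    show "cmod (W i x) \<le> 432 * B" if "x \<in> unit_cube" for i x by (rule Wb[OF that])
    show "\<exists>d. 0 < d \<and> (\<forall>i y. y \<in> unit_cube \<and> norm (x - y) < d \<longrightarrow> cmod (W i x - W i y) < \<epsilon>)"
      if "x \<in> unit_cube" "0 < \<epsilon>" for x \<epsilon> by (rule equi[OF that])
  qed blast
  have \<sigma>_top: "filterlim \<sigma> at_top sequentially" by (rule filterlim_subseq[OF \<sigma>])
  define \<delta> where "\<delta> i = r i + 432 * ((3 * k + 2) * B) / real (n i)" for i
  have inv_n: "(\<lambda>i. 1 / real (n i)) \<longlonglongrightarrow> 0"
    using filterlim_compose[OF lim_inverse_n' n(2)] by (simp add: o_def)
  have \<delta>: "\<delta> \<longlonglongrightarrow> 0"
    using tendsto_add[OF r tendsto_mult_right[OF inv_n, of "432 * ((3 * k + 2) * B)"]]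
    by (simp add: \<delta>_def[abs_def])
  have \<delta>\<sigma>: "(\<lambda>i. \<delta> (\<sigma> i)) \<longlonglongrightarrow> 0"
    by (rule filterlim_compose[OF \<delta> \<sigma>_top])
  \<comment> \<open>By quadrature the residual bound says that the grid function is nearly \<open>- W i\<close>.\<close>
  have eW: "cmod (e i x + W i x) \<le> \<delta> i" if x: "x \<in> cube_centers (n i)" for i x
  proof -
    have "cmod (W i x - discrete_potential k (n i) (F i) x) \<le> 432 * ((3 * k + 2) * B) / real (n i)"
      unfolding W_def by (rule discrete_potential_quadrature[OF k n(1) x B0 F])
    moreover have "cmod (e i x + discrete_potential k (n i) (F i) x) \<le> r i"
      using res[OF x] unfolding F_def[abs_def] discrete_potential_cmult .
    ultimately show ?thesis
      using norm_triangle_ineq[of "W i x - discrete_potential k (n i) (F i) x"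
          "e i x + discrete_potential k (n i) (F i) x"]
      by (simp add: \<delta>_def add.commute[of "W i x" "e i x"])
  qed
  \<comment> \<open>Hence the densities of the potentials converge almost everywhere to \<open>- p w\<close>.\<close>
  have pw: "AE y in lborel. y \<in> unit_cube \<longrightarrow>
      (\<lambda>i. step_fun (n (\<sigma> i)) (F (\<sigma> i)) y) \<longlonglongrightarrow> - (p y * w y)"
  proof -
    have "AE y in lborel. \<forall>i. y \<in> unit_cube \<longrightarrow>
        (\<exists>z\<in>cube_centers (n (\<sigma> i)). y \<in> cell (n (\<sigma> i)) z \<and> norm (y - z) \<le> 1 / real (n (\<sigma> i))
           \<and> (\<forall>F. step_fun (n (\<sigma> i)) F y = F z))"
      using AE_cell[OF n(1)] by (simp only: AE_all_countable) blast
    then show ?thesis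
    proof eventually_elim
      case (elim y)
      show ?case
      proof
        assume y: "y \<in> unit_cube"
        then obtain z where z: "\<And>i. z i \<in> cube_centers (n (\<sigma> i))"
          "\<And>i. norm (y - z i) \<le> 1 / real (n (\<sigma> i))" "\<And>i F. step_fun (n (\<sigma> i)) F y = F (z i)"
          using elim by metis
        have zD: "z i \<in> unit_cube" for i by (rule cube_centers_subset[OF n(1) z(1)])
        have zy: "z \<longlonglongrightarrow> y"
        proof (rule LIM_zero_cancel, rule Lim_null_comparison)
          show "(\<lambda>i. 1 / real (n (\<sigma> i))) \<longlonglongrightarrow> 0"
            by (rule filterlim_compose[OF inv_n \<sigma>_top])
        qed (use z(2) in \<open>simp add: norm_minus_commute\<close>)
        have pz: "(\<lambda>i. p (z i)) \<longlonglongrightarrow> p y" and wz: "(\<lambda>i. w (z i)) \<longlonglongrightarrow> w y"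
          using continuous_on_tendsto_compose[OF p zy y] continuous_on_tendsto_compose[OF w zy y] zD
          by auto
        have "(\<lambda>i. e (\<sigma> i) (z i) + W (\<sigma> i) (z i)) \<longlonglongrightarrow> 0"
          by (rule Lim_null_comparison[OF _ \<delta>\<sigma>]) (use eW z(1) in auto)
        moreover have "(\<lambda>i. W (\<sigma> i) (z i) - w (z i)) \<longlonglongrightarrow> 0"
          unfolding LIMSEQ_iff using lim zD by (metis diff_zero)
        ultimately have "(\<lambda>i. (e (\<sigma> i) (z i) + W (\<sigma> i) (z i)) - (W (\<sigma> i) (z i) - w (z i)) - w (z i))
            \<longlonglongrightarrow> 0 - 0 - w y"
          by (intro tendsto_diff wz)
        then have ez: "(\<lambda>i. e (\<sigma> i) (z i)) \<longlonglongrightarrow> - w y" by simp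
        have "(\<lambda>i. of_real (s (\<sigma> i)) * (p (z i) * e (\<sigma> i) (z i))) \<longlonglongrightarrow> of_real 1 * (p y * (- w y))"
          by (intro tendsto_mult tendsto_of_real pz ez filterlim_compose[OF s \<sigma>_top])
        then show "(\<lambda>i. step_fun (n (\<sigma> i)) (F (\<sigma> i)) y) \<longlonglongrightarrow> - (p y * w y)"
          by (simp add: z(3) F_def)
      qed
    qed
  qed
  have pwc: "continuous_on unit_cube (\<lambda>y. p y * w y)"
    by (intro continuous_intros p w)
  \<comment> \<open>Dominated convergence in the potentials, with the kernel \<open>1/r\<^sup>2\<close> as majorant.\<close>
  have w0: "w x + volume_potential k (\<lambda>y. p y * w y) x = 0" if x: "x \<in> unit_cube" for x
  proof -
    let ?f = "\<lambda>y. indicator unit_cube y *\<^sub>R (green k x y * - (p y * w y))"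
    let ?g = "\<lambda>i y. indicator unit_cube y *\<^sub>R (green k x y * step_fun (n (\<sigma> i)) (F (\<sigma> i)) y)"
    let ?b = "\<lambda>y. indicator unit_cube y *\<^sub>R (B * (1 / (norm (x - y))\<^sup>2))"
    have "(\<lambda>i. integral\<^sup>L lborel (?g i)) \<longlonglongrightarrow> integral\<^sup>L lborel ?f"
    proof (rule integral_dominated_convergence)
      have "set_borel_measurable lborel unit_cube (\<lambda>y. - (p y * w y))"
        unfolding set_borel_measurable_def
        using borel_measurable_continuous_on_indicator[OF _ continuous_on_minus[OF pwc]] by simp
      from set_borel_measurable_green_mult[OF this, of k x]
      show "?f \<in> borel_measurable lborel" unfolding set_borel_measurable_def .
      show "?g i \<in> borel_measurable lborel" for i by measurable
      show "integrable lborel ?b"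
        using set_integrable_mult_right[OF inverse_square_integrable_cube(1)[OF x], of B]
        unfolding set_integrable_def by simp
      show "AE y in lborel. (\<lambda>i. ?g i y) \<longlonglongrightarrow> ?f y"
        using pw
      proof eventually_elim
        case (elim y)
        then show ?case
          using tendsto_mult_left[of _ "- (p y * w y)" sequentially "green k x y"]
          by (cases "y \<in> unit_cube") auto
      qed
      show "AE y in lborel. norm (?g i y) \<le> ?b y" for i
      proof (rule AE_I2)
        fix y :: "real^3"
        have "cmod (green k x y) * cmod (step_fun (n (\<sigma> i)) (F (\<sigma> i)) y) \<le> 1 / (norm (x - y))\<^sup>2 * B"
          if "y \<in> unit_cube"
          using that by (intro mult_mono norm_green_le x norm_step_fun_le n(1) B0 F) auto
        then show "norm (?g i y) \<le> ?b y"
          by (cases "y \<in> unit_cube") (auto simp: norm_mult mult.commute)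
      qed
    qed
    then have "(\<lambda>i. W (\<sigma> i) x) \<longlonglongrightarrow> - volume_potential k (\<lambda>y. p y * w y) x"
      by (simp add: W_def volume_potential_def set_lebesgue_integral_def)
    moreover have "(\<lambda>i. W (\<sigma> i) x) \<longlonglongrightarrow> w x"
      unfolding LIMSEQ_iff using lim x by blast
    ultimately show ?thesis
      using LIMSEQ_unique by fastforce
  qed
  have wz: "w x = 0" if "x \<in> unit_cube" for x
    using inj w w0 that by blast
  obtain N1 where N1: "\<And>i x. i \<ge> N1 \<Longrightarrow> x \<in> unit_cube \<Longrightarrow> cmod (W (\<sigma> i) x - w x) < 1 / 2"
    using lim[of "1/2"] by auto
  obtain N2 where N2: "\<And>i. i \<ge> N2 \<Longrightarrow> \<delta> (\<sigma> i) < 1 / 2"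
    using order_tendstoD(2)[OF \<delta>\<sigma>, of "1/2"] by (auto simp: eventually_sequentially)
  define i where "i = max N1 N2"
  have "cmod (e (\<sigma> i) x) < 1" if x: "x \<in> cube_centers (n (\<sigma> i))" for x
  proof -
    have xD: "x \<in> unit_cube" by (rule cube_centers_subset[OF n(1) x])
    have "cmod (W (\<sigma> i) x) < 1 / 2"
      using N1[of i x] xD wz[OF xD] by (simp add: i_def)
    moreover have "cmod (e (\<sigma> i) x + W (\<sigma> i) x) < 1 / 2"
      using eW[OF x] N2[of i] by (simp add: i_def)
    ultimately show ?thesis
      using norm_triangle_ineq4[of "e (\<sigma> i) x + W (\<sigma> i) x" "W (\<sigma> i) x"] by simp
  qed
  then show ?thesis by blast
qed

text \<open>
A violation of the bound with constant \<open>i + 1\<close>, for every \<open>i\<close> and for arbitrarily large \<open>m\<close>, yields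
after normalization a sequence of grid functions of maximum 1 with residuals at most \<open>1/(i + 1)\<close>,
contrary to the preceding lemma.
\<close>

lemma discrete_stability:
  fixes n :: "nat \<Rightarrow> nat" and s :: "nat \<Rightarrow> real"
  assumes k: "k \<ge> 0" and p: "continuous_on unit_cube p"
    and inj: "\<forall>w. continuous_on unit_cube w \<longrightarrow>
       (\<forall>x\<in>unit_cube. w x + volume_potential k (\<lambda>y. p y * w y) x = 0) \<longrightarrow> (\<forall>x\<in>unit_cube. w x = 0)"
    and n: "filterlim n at_top sequentially" and s: "s \<longlonglongrightarrow> 1"
  obtains C where "C > 0"
    "\<forall>\<^sub>F m in sequentially. \<forall>e R.
       (\<forall>x\<in>cube_centers (n m). cmod (e x + of_real (s m) * discrete_potential k (n m) (\<lambda>z. p z * e z) x) \<le> R) \<longrightarrow>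
       (\<forall>x\<in>cube_centers (n m). cmod (e x) \<le> C * R)"
proof -
  define res where "res m e x = cmod (e x + of_real (s m) * discrete_potential k (n m) (\<lambda>z. p z * e z) x)" for m e x
  define good where "good C m \<longleftrightarrow> (\<forall>e R. (\<forall>x\<in>cube_centers (n m). res m e x \<le> R) \<longrightarrow>
       (\<forall>x\<in>cube_centers (n m). cmod (e x) \<le> C * R))" for C m
  have "\<exists>C>0. \<forall>\<^sub>F m in sequentially. good C m"
  proof (rule ccontr)
    assume *: "\<not> ?thesis"
    have "\<exists>m e. m \<ge> i \<and> n m > 0 \<and> (\<forall>x\<in>cube_centers (n m). cmod (e x) \<le> 1)
        \<and> (\<exists>x\<in>cube_centers (n m). cmod (e x) = 1)
        \<and> (\<forall>x\<in>cube_centers (n m). res m e x \<le> 1 / real (Suc i))" for i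
    proof -
      have "\<exists>\<^sub>F m in sequentially. \<not> good (real (Suc i)) m"
        using * by (auto simp: frequently_def)
      moreover have "\<forall>\<^sub>F m in sequentially. m \<ge> i \<and> n m > 0"
        using eventually_ge_at_top[of i] filterlim_at_top[THEN iffD1, OF n, rule_format, of 1]
        by eventually_elim simp
      ultimately obtain m where m: "\<not> good (real (Suc i)) m" "m \<ge> i" "n m > 0"
        using frequently_ex[OF frequently_eventually_conj] by blast
      then obtain e R x where R: "\<And>x. x \<in> cube_centers (n m) \<Longrightarrow> res m e x \<le> R"
        and x: "x \<in> cube_centers (n m)" and ex: "cmod (e x) > real (Suc i) * R"
        by (auto simp: good_def not_le)
      define E where "E = Max ((\<lambda>x. cmod (e x)) ` cube_centers (n m))"
      have ne: "(\<lambda>x. cmod (e x)) ` cube_centers (n m) \<noteq> {}" using x by blast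
      have fin: "finite ((\<lambda>x. cmod (e x)) ` cube_centers (n m))" using finite_cube_centers by blast
      have Emax: "cmod (e y) \<le> E" if "y \<in> cube_centers (n m)" for y
        unfolding E_def using fin that by (intro Max_ge) auto
      obtain x0 where x0: "x0 \<in> cube_centers (n m)" "cmod (e x0) = E"
        using Max_in[OF fin ne] by (auto simp: E_def)
      have R0: "R \<ge> 0" using R[OF x] order_trans[OF norm_ge_zero] by (auto simp: res_def)
      have ER: "real (Suc i) * R < E" using ex Emax[OF x] by linarith
      have E0: "E > 0" by (rule le_less_trans[OF _ ER]) (use R0 in simp)
      \<comment> \<open>Dividing by the maximum \<open>E > (i + 1) R\<close> makes the residual at most \<open>1/(i + 1)\<close>.\<close>
      define e' where "e' y = of_real (1 / E) * e y" for y
      have ne': "cmod (e' y) = cmod (e y) / E" for y 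
        using E0 by (simp only: e'_def norm_mult norm_of_real) simp
      have "res m e' y = res m e y / E" for y
      proof -
        have "(\<lambda>z. p z * e' z) = (\<lambda>z. of_real (1 / E) * (p z * e z))"
          by (simp add: e'_def fun_eq_iff)
        then have "e' y + of_real (s m) * discrete_potential k (n m) (\<lambda>z. p z * e' z) y
           = of_real (1 / E) * (e y + of_real (s m) * discrete_potential k (n m) (\<lambda>z. p z * e z) y)"
          by (simp only: discrete_potential_cmult) (simp add: e'_def algebra_simps)
        then show ?thesis using E0 by (simp only: res_def norm_mult norm_of_real) simp
      qed
      moreover have "res m e y / E \<le> 1 / real (Suc i)" if "y \<in> cube_centers (n m)" for y
      proof -
        have "res m e y * real (Suc i) \<le> R * real (Suc i)"
          by (intro mult_right_mono R that) simp
        then have "res m e y * real (Suc i) \<le> E" 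
          using ER mult.commute[of R "real (Suc i)"] by linarith
        then show ?thesis using E0 by (simp add: field_simps del: of_nat_Suc)
      qed
      ultimately show ?thesis
        using m x0 Emax E0 ne' by (intro exI[of _ m] exI[of _ e']) (auto intro!: bexI[of _ x0])
    qed
    then obtain \<mu> e where \<mu>: "\<And>i. \<mu> i \<ge> i" "\<And>i. n (\<mu> i) > 0"
      and e1: "\<And>i x. x \<in> cube_centers (n (\<mu> i)) \<Longrightarrow> cmod (e i x) \<le> 1"
      and e2: "\<And>i. \<exists>x\<in>cube_centers (n (\<mu> i)). cmod (e i x) = 1"
      and e3: "\<And>i x. x \<in> cube_centers (n (\<mu> i)) \<Longrightarrow> res (\<mu> i) (e i) x \<le> 1 / real (Suc i)"
      by metis
    have \<mu>_top: "filterlim \<mu> at_top sequentially"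
      using \<mu>(1) by (intro filterlim_at_top_mono[OF filterlim_ident]) auto
    have r: "(\<lambda>i. 1 / real (Suc i)) \<longlonglongrightarrow> 0"
      using LIMSEQ_inverse_real_of_nat by (simp add: inverse_eq_divide)
    have "\<exists>i. \<forall>x\<in>cube_centers (n (\<mu> i)). cmod (e i x) < 1"
      by (rule discrete_homogeneous_limit[where n = "\<lambda>i. n (\<mu> i)" and e = e,
            OF k p inj \<mu>(2) filterlim_compose[OF n \<mu>_top]
            filterlim_compose[OF s \<mu>_top] r e1 e3[unfolded res_def]])
    then show False using e2 by (metis less_irrefl)
  qed
  then show thesis
    using that unfolding good_def res_def by blast
qed

section \<open>The data of the scattering problem\<close>

text \<open>
Boundedness of \<open>p\<close> is what makes the supremum in the modulus of continuity meaningful.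
\<close>

lemma modulus_of_continuity_bound:
  assumes p: "\<And>y. y \<in> unit_cube \<Longrightarrow> cmod (p y) \<le> B"
    and xy: "x \<in> unit_cube" "y \<in> unit_cube" "norm (x - y) \<le> t"
  shows "cmod (p x - p y) \<le> modulus_of_continuity p t"
proof -
  let ?S = "{cmod (p x - p y) |x y. x \<in> unit_cube \<and> y \<in> unit_cube \<and> norm (x - y) \<le> t}"
  have "c \<le> B + B" if c: "c \<in> ?S" for c
  proof -
    obtain x y where "c = cmod (p x - p y)" "x \<in> unit_cube" "y \<in> unit_cube"
      using c by blast
    then show ?thesis
      using norm_triangle_ineq4[of "p x" "p y"] p[of x] p[of y] by linarith
  qed
  then have "bdd_above ?S" by (rule bdd_aboveI)
  then show ?thesis
    unfolding modulus_of_continuity_def by (rule cSup_upper[rotated]) (use xy in blast)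
qed

lemma plane_wave_lipschitz:
  assumes "norm \<alpha> = 1" "k \<ge> 0"
  shows "cmod (plane_wave k \<alpha> x - plane_wave k \<alpha> y) \<le> k * norm (x - y)"
proof -
  have "cmod (plane_wave k \<alpha> x - plane_wave k \<alpha> y) \<le> \<bar>k * (\<alpha> \<bullet> x) - k * (\<alpha> \<bullet> y)\<bar>"
    unfolding plane_wave_def by (rule norm_exp_i_diff_le)
  also have "\<dots> = k * \<bar>\<alpha> \<bullet> (x - y)\<bar>"
    using assms by (simp add: inner_diff_right abs_mult flip: right_diff_distrib)
  also have "\<dots> \<le> k * (norm \<alpha> * norm (x - y))"
    by (intro mult_left_mono Cauchy_Schwarz_ineq2 assms)
  finally show ?thesis using assms by simp
qed

text \<open>
Since \<open>\<gamma> a^((2-\<kappa>)/3) \<le> 1/n\<close> and \<open>3/(2-\<kappa>) > 1\<close>, the radius \<open>a\<close> is of smaller order than \<open>1/n\<close>. The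
cube of the equation multiplied by \<open>n\<close> expresses the quantity in question as \<open>(1 - 2 n a)^3\<close>.
\<close>

lemma radius_scaling_limit:
  fixes a :: "nat \<Rightarrow> real"
  assumes \<gamma>: "\<gamma> > 0" and \<kappa>: "0 < \<kappa>" "\<kappa> < 1"
    and n: "filterlim n at_top sequentially" "\<forall>\<^sub>F m in sequentially. (n m :: nat) > 0"
    and a: "\<forall>\<^sub>F m in sequentially. 0 < a (n m) \<and> 1 / real (n m) - 2 * a (n m) = \<gamma> * a (n m) powr ((2 - \<kappa>) / 3)"
  shows "(\<lambda>m. \<gamma> ^ 3 * real (n m) ^ 3 * a (n m) powr (2 - \<kappa>)) \<longlonglongrightarrow> 1"
proof -
  define q where "q = 3 / (2 - \<kappa>)"
  have q: "q > 1" using \<kappa> by (simp add: q_def field_simps)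
  have bnd: "\<forall>\<^sub>F m in sequentially. norm (real (n m) * a (n m)) \<le> (1 / \<gamma>) powr q * real (n m) powr (1 - q)"
    using a n(2)
  proof eventually_elim
    case (elim m)
    have "\<gamma> * a (n m) powr ((2 - \<kappa>) / 3) \<le> 1 / real (n m)" using elim by linarith
    then have "a (n m) powr ((2 - \<kappa>) / 3) \<le> (1 / real (n m)) / \<gamma>"
      using \<gamma> by (simp only: pos_le_divide_eq mult.commute)
    then have "a (n m) powr ((2 - \<kappa>) / 3) \<le> (1 / \<gamma>) * (1 / real (n m))"
      by (simp add: mult.commute)
    then have "(a (n m) powr ((2 - \<kappa>) / 3)) powr q \<le> ((1 / \<gamma>) * (1 / real (n m))) powr q"
      using q by (intro powr_mono2) auto
    moreover have "(a (n m) powr ((2 - \<kappa>) / 3)) powr q = a (n m)"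
    proof -
      have "(2 - \<kappa>) / 3 * q = 1" using \<kappa> by (simp add: q_def)
      then show ?thesis using elim by (simp only: powr_powr) simp
    qed
    moreover have "((1 / \<gamma>) * (1 / real (n m))) powr q = (1 / \<gamma>) powr q * real (n m) powr (- q)"
      using \<gamma> elim by (simp add: powr_mult powr_minus_divide powr_divide)
    ultimately have "a (n m) \<le> (1 / \<gamma>) powr q * real (n m) powr (- q)" by simp
    then have "real (n m) * a (n m) \<le> real (n m) * ((1 / \<gamma>) powr q * real (n m) powr (- q))"
      by (rule mult_left_mono) simp
    also have "\<dots> = (1 / \<gamma>) powr q * (real (n m) powr 1 * real (n m) powr (- q))"
      using elim by simp
    also have "\<dots> = (1 / \<gamma>) powr q * real (n m) powr (1 - q)"
      by (simp only: flip: powr_add) simp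
    finally show ?case using elim by simp
  qed
  have "(\<lambda>m. real (n m) powr (1 - q)) \<longlonglongrightarrow> 0"
    using q by (intro tendsto_neg_powr filterlim_compose[OF filterlim_real_sequentially n(1)]) auto
  then have "(\<lambda>m. (1 / \<gamma>) powr q * real (n m) powr (1 - q)) \<longlonglongrightarrow> 0"
    by (rule tendsto_mult_right_zero)
  then have na: "(\<lambda>m. real (n m) * a (n m)) \<longlonglongrightarrow> 0"
    by (rule Lim_null_comparison[OF bnd])
  have "(\<lambda>m. (1 - 2 * (real (n m) * a (n m))) ^ 3) \<longlonglongrightarrow> (1 - 2 * 0) ^ 3"
    by (intro tendsto_intros na)
  moreover have "\<forall>\<^sub>F m in sequentially. (1 - 2 * (real (n m) * a (n m))) ^ 3
      = \<gamma> ^ 3 * real (n m) ^ 3 * a (n m) powr (2 - \<kappa>)"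
    using a n(2)
  proof eventually_elim
    case (elim m)
    have "1 - 2 * (real (n m) * a (n m)) = real (n m) * (1 / real (n m) - 2 * a (n m))"
      using elim by (simp add: field_simps)
    also have "\<dots> = real (n m) * (\<gamma> * a (n m) powr ((2 - \<kappa>) / 3))"
      using elim by simp
    finally have "(1 - 2 * (real (n m) * a (n m))) ^ 3
        = \<gamma> ^ 3 * real (n m) ^ 3 * (a (n m) powr ((2 - \<kappa>) / 3)) ^ 3"
      by (simp add: power_mult_distrib)
    also have "(a (n m) powr ((2 - \<kappa>) / 3)) ^ 3 = a (n m) powr (2 - \<kappa>)"
    proof -
      have "(a (n m) powr ((2 - \<kappa>) / 3)) ^ 3 = (a (n m) powr ((2 - \<kappa>) / 3)) powr 3"
        by simp
      also have "\<dots> = a (n m) powr ((2 - \<kappa>) / 3 * 3)" by (rule powr_powr)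
      also have "(2 - \<kappa>) / 3 * 3 = 2 - \<kappa>" by simp
      finally show ?thesis .
    qed
    finally show ?case .
  qed
  ultimately show ?thesis by (simp add: tendsto_cong)
qed

text \<open>
The density \<open>1/\<gamma>^3\<close> turns \<open>4 \<pi> h\<close> into \<open>\<gamma>^3 p\<close>; the weight \<open>\<gamma>^3 a^(2-\<kappa>)\<close> of the system is then
compared with the weight \<open>n^-3\<close> of the midpoint rule.
\<close>

lemma linear_system_as_discrete_potential:
  assumes n: "n > 0" and c: "bij_betw c {1..n ^ 3} (cube_centers n)" and \<gamma>: "\<gamma> > 0"
    and sys: "solves_linear_system k \<alpha> h \<kappa> a (n ^ 3) c v"
    and l: "l \<in> {1..n ^ 3}" and V: "\<And>j. j \<in> {1..n ^ 3} \<Longrightarrow> V (c j) = v j"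
  shows "v l + of_real (\<gamma> ^ 3 * real n ^ 3 * a powr (2 - \<kappa>))
           * discrete_potential k n (\<lambda>z. potential \<gamma> h z * V z) (c l) = plane_wave k \<alpha> (c l)"
proof -
  have sys_l: "v l = plane_wave k \<alpha> (c l) - 4 * complex_of_real pi *
      (\<Sum>j\<in>{1..n ^ 3} - {l}. green k (c l) (c j) * h (c j) * complex_of_real (a powr (2 - \<kappa>)) * v j)"
    using sys l unfolding solves_linear_system_def by blast
  have "4 * complex_of_real pi * (\<Sum>j\<in>{1..n ^ 3} - {l}. green k (c l) (c j) * h (c j) * complex_of_real (a powr (2 - \<kappa>)) * v j)
      = 4 * complex_of_real pi * (\<Sum>j\<in>{1..n ^ 3}. green k (c l) (c j) * h (c j) * complex_of_real (a powr (2 - \<kappa>)) * v j)"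
    using l by (subst (2) sum.remove[of _ l]) auto
  also have "\<dots> = (\<Sum>j\<in>{1..n ^ 3}. of_real (\<gamma> ^ 3 * a powr (2 - \<kappa>)) * (green k (c l) (c j) * (potential \<gamma> h (c j) * V (c j))))"
    unfolding sum_distrib_left
    by (intro sum.cong) (use \<gamma> V in \<open>simp_all add: potential_def distribution_density_def field_simps\<close>)
  also have "\<dots> = (\<Sum>z\<in>cube_centers n. of_real (\<gamma> ^ 3 * a powr (2 - \<kappa>)) * (green k (c l) z * (potential \<gamma> h z * V z)))"
    by (rule sum.reindex_bij_betw[OF c])
  also have "\<dots> = of_real (\<gamma> ^ 3 * real n ^ 3 * a powr (2 - \<kappa>)) * discrete_potential k n (\<lambda>z. potential \<gamma> h z * V z) (c l)"
    using n by (simp add: discrete_potential_def flip: sum_distrib_left)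
  finally show ?thesis using sys_l by simp
qed

section \<open>The error estimate\<close>

theorem theorem3p5:
  fixes k \<gamma> \<kappa> :: real and P :: nat and \<alpha> :: "real^3"
    and h u p :: "real^3 \<Rightarrow> complex"
    and c :: "nat \<Rightarrow> nat \<Rightarrow> real^3"
    and a :: "nat \<Rightarrow> real"
    and ue :: "nat \<Rightarrow> nat \<Rightarrow> complex"
    and M :: "nat \<Rightarrow> nat"
  assumes k: "k > 0" and \<gamma>: "\<gamma> > 0" and \<kappa>: "0 < \<kappa>" "\<kappa> < 1" and P: "P > 0"
    and \<alpha>: "norm \<alpha> = 1"
    and Im_h: "\<And>x. x \<in> unit_cube \<Longrightarrow> Im (h x) \<le> 0"
    and p_def: "p = potential \<gamma> h"
    and p_cont: "continuous_on unit_cube p"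
    and p_mod: "\<And>x y. x \<in> unit_cube \<Longrightarrow> y \<in> unit_cube \<Longrightarrow>
                  cmod (p x - p y) \<le> modulus_of_continuity p (norm (x - y))"
    and u: "solves_integral_equation k \<alpha> p u"
    and u_unique: "\<And>v. solves_integral_equation k \<alpha> p v \<Longrightarrow> (\<forall>x\<in>unit_cube. v x = u x)"
    and M_def: "\<And>m. M m = (m * P) ^ 3"
    and centers: "\<And>m. m \<ge> 1 \<Longrightarrow> bij_betw (c m) {1..M m} (cube_centers (m * P))"
    and a_range: "\<And>m. m \<ge> 1 \<Longrightarrow> 0 < a (m * P) \<and> a (m * P) < 1 / real (m * P)"
    and a_eq: "\<And>m. m \<ge> 1 \<Longrightarrow>
                 1 / real (m * P) - 2 * a (m * P) = \<gamma> * a (m * P) powr ((2 - \<kappa>) / 3)"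
    and ue: "\<forall>\<^sub>F m in sequentially. solves_linear_system k \<alpha> h \<kappa> (a (m * P)) (M m) (c m) (ue m)"
  shows "(\<lambda>m. max_norm (M m) (\<lambda>j. u (c m j) - ue m j))
           \<in> O[sequentially](\<lambda>m. ln (real (M m)) / real (M m) powr (1 / 3)
                + \<bar>1 - \<gamma> ^ 3 * real (M m) * a (m * P) powr (2 - \<kappa>)\<bar>
                + modulus_of_continuity p (1 / real (M m) powr (1 / 3)))"
proof -
  have k0: "k \<ge> 0" using k by simp
  have uc: "continuous_on unit_cube u"
    and ueq: "\<And>x. x \<in> unit_cube \<Longrightarrow> u x + volume_potential k (\<lambda>y. p y * u y) x = plane_wave k \<alpha> x"
    using u unfolding solves_integral_equation_def volume_potential_def by (auto simp: mult.assoc)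
  obtain Bp where Bp: "Bp > 0" "\<And>y. y \<in> unit_cube \<Longrightarrow> cmod (p y) \<le> Bp"
    using compact_imp_bounded[OF compact_continuous_image[OF p_cont compact_cbox]]
    by (auto simp: bounded_pos)
  obtain Bu where Bu: "Bu > 0" "\<And>y. y \<in> unit_cube \<Longrightarrow> cmod (u y) \<le> Bu"
    using compact_imp_bounded[OF compact_continuous_image[OF uc compact_cbox]]
    by (auto simp: bounded_pos)
  have dens: "bounded_density (Bp * Bu) (\<lambda>y. p y * u y)"
    using Bp Bu by (intro bounded_density_mult p_cont uc) auto
  define L where "L = k + 432 * ((3 * k + 1) * (Bp * Bu))"
  have L0: "L \<ge> 0" using k Bp Bu by (simp add: L_def)
  have lip: "cmod (u y - u z) \<le> L * norm (y - z)" if yz: "y \<in> unit_cube" "z \<in> unit_cube" for y z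
  proof -
    let ?T = "volume_potential k (\<lambda>y. p y * u y)"
    have ueq': "u v = plane_wave k \<alpha> v - ?T v" if "v \<in> unit_cube" for v
      using ueq[OF that] by (simp add: eq_diff_eq)
    have "u y - u z = (plane_wave k \<alpha> y - plane_wave k \<alpha> z) - (?T y - ?T z)"
      by (simp only: ueq'[OF yz(1)] ueq'[OF yz(2)]) simp
    then have "cmod (u y - u z) \<le> cmod (plane_wave k \<alpha> y - plane_wave k \<alpha> z) + cmod (?T y - ?T z)"
      by (metis norm_triangle_ineq4)
    also have "\<dots> \<le> k * norm (y - z) + 432 * ((3 * k + 1) * (Bp * Bu)) * norm (y - z)"
      by (intro add_mono plane_wave_lipschitz volume_potential_lipschitz dens yz k0 \<alpha>)
    finally show ?thesis by (simp add: L_def algebra_simps)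
  qed
  \<comment> \<open>A solution of the homogeneous equation can be subtracted from \<open>u\<close>, so uniqueness makes it vanish.\<close>
  have inj: "w x = 0" if w: "continuous_on unit_cube w"
    and w0: "\<And>x. x \<in> unit_cube \<Longrightarrow> w x + volume_potential k (\<lambda>y. p y * w y) x = 0"
    and x: "x \<in> unit_cube" for w x
  proof -
    obtain Bw where Bw: "Bw > 0" "\<And>y. y \<in> unit_cube \<Longrightarrow> cmod (w y) \<le> Bw"
      using compact_imp_bounded[OF compact_continuous_image[OF w compact_cbox]]
      by (auto simp: bounded_pos)
    have densw: "bounded_density (Bp * Bw) (\<lambda>y. p y * w y)"
      using Bp Bw by (intro bounded_density_mult p_cont w) auto
    have "solves_integral_equation k \<alpha> p (\<lambda>y. u y - w y)"
      unfolding solves_integral_equation_def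
    proof (intro conjI ballI)
      show "continuous_on unit_cube (\<lambda>y. u y - w y)" by (intro continuous_intros uc w)
      fix y assume y: "y \<in> unit_cube"
      have split: "(LINT z:unit_cube|lborel. green k y z * p z * (u z - w z))
          = volume_potential k (\<lambda>z. p z * u z) y - volume_potential k (\<lambda>z. p z * w z) y"
        using volume_potential_diff[where k = k, OF dens densw y]
        by (simp add: volume_potential_def right_diff_distrib mult.assoc)
      show "u y - w y + (LINT z:unit_cube|lborel. green k y z * p z * (u z - w z)) = plane_wave k \<alpha> y"
        unfolding split using ueq[OF y] w0[OF y] by (simp add: algebra_simps)
    qed
    from u_unique[OF this] x show ?thesis by simp
  qed
  define n where "n m = m * P" for m
  have n_top: "filterlim n at_top sequentially"
    unfolding n_def[abs_def] using P by (intro filterlim_at_top_mono[OF filterlim_ident]) auto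
  define s where "s m = \<gamma> ^ 3 * real (n m) ^ 3 * a (n m) powr (2 - \<kappa>)" for m
  have s1: "s \<longlonglongrightarrow> 1"
    unfolding s_def[abs_def]
  proof (rule radius_scaling_limit[OF \<gamma> \<kappa> n_top])
    show "\<forall>\<^sub>F m in sequentially. n m > 0"
      using eventually_ge_at_top[of 1] by eventually_elim (use P in \<open>simp add: n_def\<close>)
    show "\<forall>\<^sub>F m in sequentially. 0 < a (n m) \<and> 1 / real (n m) - 2 * a (n m) = \<gamma> * a (n m) powr ((2 - \<kappa>) / 3)"
      using eventually_ge_at_top[of 1] unfolding n_def by eventually_elim (use a_range a_eq in blast)
  qed
  obtain C where C: "C > 0" and stable: "\<forall>\<^sub>F m in sequentially. \<forall>e R.
       (\<forall>x\<in>cube_centers (n m). cmod (e x + of_real (s m) * discrete_potential k (n m) (\<lambda>z. p z * e z) x) \<le> R) \<longrightarrow>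
       (\<forall>x\<in>cube_centers (n m). cmod (e x) \<le> C * R)"
  proof (rule discrete_stability[OF k0 p_cont _ n_top s1])
    show "\<forall>w. continuous_on unit_cube w \<longrightarrow>
       (\<forall>x\<in>unit_cube. w x + volume_potential k (\<lambda>y. p y * w y) x = 0) \<longrightarrow> (\<forall>x\<in>unit_cube. w x = 0)"
      using inj by blast
  qed
  define \<omega> where "\<omega> m = modulus_of_continuity p (1 / real (n m))" for m
  define K where "K = 432 * Bu + (432 * (Bp * L) + 432 * ((3 * k + 2) * (Bp * Bu))) + 432 * ((3 * k + 3) * (Bp * Bu))"
  have Kpos: "0 \<le> 432 * Bu" "0 \<le> 432 * (Bp * L) + 432 * ((3 * k + 2) * (Bp * Bu))" "0 \<le> 432 * ((3 * k + 3) * (Bp * Bu))"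
    using k Bp Bu L0 by simp_all
  have "\<forall>\<^sub>F m in sequentially. norm (max_norm (M m) (\<lambda>j. u (c m j) - ue m j))
      \<le> (C * K) * norm (ln (real (M m)) / real (M m) powr (1 / 3)
                + \<bar>1 - \<gamma> ^ 3 * real (M m) * a (m * P) powr (2 - \<kappa>)\<bar>
                + modulus_of_continuity p (1 / real (M m) powr (1 / 3)))"
    using stable ue eventually_ge_at_top[of 3]
  proof eventually_elim
    case (elim m)
    have n0: "n m > 0" and m1: "m \<ge> 1" and n3: "n m \<ge> 3"
      using P elim by (auto simp: n_def intro: order_trans[of 3 m])
    have Mn: "M m = n m ^ 3" by (simp add: M_def n_def)
    have c: "bij_betw (c m) {1..n m ^ 3} (cube_centers (n m))"
      using centers[OF m1] Mn by (simp add: n_def)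
    have root: "real (M m) powr (1 / 3) = real (n m)"
    proof -
      have "real (M m) = real (n m) powr 3"
        using n0 by (simp add: Mn)
      then have "real (M m) powr (1 / 3) = real (n m) powr (3 * (1 / 3))"
        by (simp only: powr_powr)
      then show ?thesis using n0 by simp
    qed
    have sM: "\<gamma> ^ 3 * real (M m) * a (m * P) powr (2 - \<kappa>) = s m"
      by (simp add: s_def Mn n_def)
    have inD: "z \<in> unit_cube" if "z \<in> cube_centers (n m)" for z
      by (rule cube_centers_subset[OF n0 that])
    have osc: "cmod (p y - p z) \<le> \<omega> m" if "y \<in> unit_cube" "z \<in> unit_cube" "norm (y - z) \<le> 1 / real (n m)" for y z
      unfolding \<omega>_def by (rule modulus_of_continuity_bound[OF Bp(2) that])
    have \<omega>0: "\<omega> m \<ge> 0"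
      using osc[of 0 0] by (simp add: mem_box_cart)
    \<comment> \<open>The unknowns, indexed by the centers instead of their numbers.\<close>
    define V where "V z = ue m (inv_into {1..n m ^ 3} (c m) z)" for z
    have V: "V (c m j) = ue m j" if "j \<in> {1..n m ^ 3}" for j
      using that c by (simp add: V_def bij_betw_inv_into_left)
    define \<rho> where "\<rho> = 1 / real (n m) + \<bar>1 - s m\<bar> + \<omega> m"
    have residual: "cmod ((u x - V x) + of_real (s m) * discrete_potential k (n m) (\<lambda>z. p z * (u z - V z)) x) \<le> K * \<rho>"
      if x: "x \<in> cube_centers (n m)" for x
    proof -
      obtain l where l: "l \<in> {1..n m ^ 3}" "x = c m l"
        using x c unfolding bij_betw_def by blast
      have "solves_linear_system k \<alpha> h \<kappa> (a (n m)) (n m ^ 3) (c m) (ue m)"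
        using elim Mn by (simp add: n_def)
      from linear_system_as_discrete_potential[OF n0 c \<gamma> this l(1) V]
      have Veq: "V x + of_real (s m) * discrete_potential k (n m) (\<lambda>z. p z * V z) x = plane_wave k \<alpha> x"
        using V[OF l(1)] by (simp add: l(2) s_def p_def)
      have "(u x - V x) + of_real (s m) * discrete_potential k (n m) (\<lambda>z. p z * (u z - V z)) x
          = (u x + of_real (s m) * discrete_potential k (n m) (\<lambda>z. p z * u z) x)
            - (V x + of_real (s m) * discrete_potential k (n m) (\<lambda>z. p z * V z) x)"
        by (simp add: right_diff_distrib discrete_potential_diff)
      also have "\<dots> = - (volume_potential k (\<lambda>y. p y * u y) x - of_real (s m) * discrete_potential k (n m) (\<lambda>z. p z * u z) x)"
        unfolding Veq using ueq[OF inD[OF x]] by (simp add: algebra_simps)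
      finally have split: "(u x - V x) + of_real (s m) * discrete_potential k (n m) (\<lambda>z. p z * (u z - V z)) x
          = - (volume_potential k (\<lambda>y. p y * u y) x - of_real (s m) * discrete_potential k (n m) (\<lambda>z. p z * u z) x)" .
      have "cmod ((u x - V x) + of_real (s m) * discrete_potential k (n m) (\<lambda>z. p z * (u z - V z)) x)
          \<le> 432 * (\<omega> m * Bu + Bp * L / real (n m)) + 432 * ((3 * k + 2) * (Bp * Bu)) / real (n m)
            + \<bar>1 - s m\<bar> * (432 * ((3 * k + 3) * (Bp * Bu)))"
        unfolding split norm_minus_cancel
        by (rule discrete_potential_consistency[OF k0 n0 x p_cont Bp(2) uc Bu(2) _ _ L0 \<omega>0 lip osc])
          (use Bp(1) Bu(1) in auto)
      also have "\<dots> = (432 * Bu) * \<omega> m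
          + (432 * (Bp * L) + 432 * ((3 * k + 2) * (Bp * Bu))) * (1 / real (n m))
          + (432 * ((3 * k + 3) * (Bp * Bu))) * \<bar>1 - s m\<bar>"
        by (simp add: algebra_simps add_divide_distrib)
      also have "\<dots> \<le> (432 * Bu) * \<rho> + (432 * (Bp * L) + 432 * ((3 * k + 2) * (Bp * Bu))) * \<rho>
          + (432 * ((3 * k + 3) * (Bp * Bu))) * \<rho>"
        by (intro add_mono mult_left_mono Kpos) (use \<omega>0 in \<open>simp_all add: \<rho>_def\<close>)
      also have "\<dots> = K * \<rho>" unfolding K_def by (simp only: distrib_right)
      finally show ?thesis .
    qed
    from elim(1)[rule_format, of "\<lambda>x. u x - V x" "K * \<rho>", OF residual]
    have err: "cmod (u x - V x) \<le> C * (K * \<rho>)" if "x \<in> cube_centers (n m)" for x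
      using that by blast
    have errj: "cmod (u (c m j) - ue m j) \<le> C * (K * \<rho>)" if "j \<in> {1..M m}" for j
      using err[of "c m j"] that V[of j] bij_betwE[OF c] by (simp add: Mn)
    have ne: "{1..M m} \<noteq> {}" using n0 by (simp add: Mn)
    have max_le: "max_norm (M m) (\<lambda>j. u (c m j) - ue m j) \<le> C * (K * \<rho>)"
      unfolding max_norm_def using errj ne by (intro Max.boundedI) auto
    have "cmod (u (c m 1) - ue m 1) \<le> max_norm (M m) (\<lambda>j. u (c m j) - ue m j)"
      unfolding max_norm_def using ne by (intro Max_ge) auto
    then have max_nonneg: "0 \<le> max_norm (M m) (\<lambda>j. u (c m j) - ue m j)"
      using norm_ge_zero order_trans by blast
    \<comment> \<open>Here \<open>m \<ge> 3\<close> enters: \<open>M \<ge> 3 > e\<close>, so \<open>1/n\<close> is dominated by the logarithmic term.\<close>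
    have "ln (real (M m)) \<ge> 1"
    proof -
      have "exp 1 \<le> (3::real)" by (rule exp_le)
      also have "\<dots> \<le> real (n m)" using n3 by simp
      also have "\<dots> \<le> real (n m) ^ 3" using n0 by (intro self_le_power) auto
      finally show ?thesis using n0 by (simp add: Mn ln_ge_iff)
    qed
    then have "1 / real (n m) \<le> ln (real (M m)) / real (M m) powr (1 / 3)"
      unfolding root by (intro divide_right_mono) auto
    then have \<rho>_le: "\<rho> \<le> ln (real (M m)) / real (M m) powr (1 / 3)
        + \<bar>1 - \<gamma> ^ 3 * real (M m) * a (m * P) powr (2 - \<kappa>)\<bar>
        + modulus_of_continuity p (1 / real (M m) powr (1 / 3))" (is "_ \<le> ?rhs")
      unfolding sM \<rho>_def \<omega>_def root by simp
    have CK: "0 \<le> C * K" using C Kpos by (simp add: K_def)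
    have "max_norm (M m) (\<lambda>j. u (c m j) - ue m j) \<le> (C * K) * \<rho>"
      using max_le by (simp add: mult.assoc)
    also have "\<dots> \<le> (C * K) * ?rhs"
      by (rule mult_left_mono[OF \<rho>_le CK])
    also have "\<dots> \<le> (C * K) * norm ?rhs"
      by (intro mult_left_mono CK) simp
    finally show ?case using max_nonneg by simp
  qed
  then show ?thesis by (rule bigoI)
qed

end
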